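(* Let $G$ be a $\mathcal{C}$-orderable group. If $G$ admits infinitely many $\mathcal{C}$-orderings, then it admits uncountably many $\mathcal{C}$-orderings. Moreover, none of these $\mathcal{C}$-orderings is isolated in the space $\mathcal{CO}(G)$ of $\mathcal{C}$-orderings of $G$.
   Context: A $\mathcal{C}$-ordering (Conradian ordering) on $G$ is a total order $\preceq$ invariant under left multiplication such that for all $f\succ id$, $g\succ id$ there is $n\in\mathbb{N}$ with $fg^n\succ g$. The space of left-orderings $\mathcal{LO}(G)$ carries the topology obtained by identifying each left-ordering with the characteristic function of its set of positive elements, as a subset of $\{0,1\}^G$ with the product topology; equivalently a basis of neighbourhoods of $\preceq$ consists of the sets of left-orderings that coincide with $\preceq$ on a given finite subset of $G$. $\mathcal{CO}(G)\subseteq\mathcal{LO}(G)$ carries the subspace topology. *)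

theory Defs
  imports "HOL-Algebra.Group" "HOL-Library.Countable_Set"
begin

definition left_ordering :: "('a, 'b) monoid_scheme \<Rightarrow> ('a \<times> 'a) set \<Rightarrow> bool" where
  "left_ordering G R \<longleftrightarrow>
     R \<subseteq> carrier G \<times> carrier G \<and>
     (\<forall>x\<in>carrier G. (x, x) \<in> R) \<and>
     antisym R \<and> trans R \<and> total_on (carrier G) R \<and>
     (\<forall>g\<in>carrier G. \<forall>x y. (x, y) \<in> R \<longrightarrow> (g \<otimes>\<^bsub>G\<^esub> x, g \<otimes>\<^bsub>G\<^esub> y) \<in> R)"

definition sless :: "('a \<times> 'a) set \<Rightarrow> 'a \<Rightarrow> 'a \<Rightarrow> bool" where
  "sless R x y \<longleftrightarrow> (x, y) \<in> R \<and> x \<noteq> y"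

definition C_ordering :: "('a, 'b) monoid_scheme \<Rightarrow> ('a \<times> 'a) set \<Rightarrow> bool" where
  "C_ordering G R \<longleftrightarrow> left_ordering G R \<and>
     (\<forall>f\<in>carrier G. \<forall>g\<in>carrier G.
        sless R \<one>\<^bsub>G\<^esub> f \<and> sless R \<one>\<^bsub>G\<^esub> g \<longrightarrow>
        (\<exists>n::nat. n \<ge> 1 \<and> sless R g (f \<otimes>\<^bsub>G\<^esub> (g [^]\<^bsub>G\<^esub> n))))"

definition CO :: "('a, 'b) monoid_scheme \<Rightarrow> ('a \<times> 'a) set set" where
  "CO G = {R. C_ordering G R}"

definition pos :: "('a, 'b) monoid_scheme \<Rightarrow> ('a \<times> 'a) set \<Rightarrow> 'a set" where
  "pos G R = {g \<in> carrier G. sless R \<one>\<^bsub>G\<^esub> g}"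

text \<open>R is isolated in CO(G) (topology from {0,1}^G via positive sets): some basic
  neighbourhood, i.e. the set of C-orderings whose positive sets agree with that of R
  on a finite subset F of G, contains only R.\<close>
definition isolated_CO :: "('a, 'b) monoid_scheme \<Rightarrow> ('a \<times> 'a) set \<Rightarrow> bool" where
  "isolated_CO G R \<longleftrightarrow>
     (\<exists>F. finite F \<and> F \<subseteq> carrier G \<and>
        (\<forall>R'\<in>CO G. pos G R' \<inter> F = pos G R \<inter> F \<longrightarrow> R' = R))"

end

theory Submission
  imports Defs "HOL-Algebra.Coset" "HOL-Analysis.Function_Topology"
begin

text \<open>A \<open>\<C>\<close>-ordering is handled through its set \<open>P\<close> of positive elements. For every element \<open>g\<close> the
  quotient of the smallest convex subgroup containing \<open>g\<close> by the largest convex subgroup not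
  containing \<open>g\<close> is abelian, and replacing the ordering on an abelian quotient of convex subgroups
  gives another \<open>\<C>\<close>-ordering.

  Suppose \<open>P\<close> is isolated by the finite set \<open>F\<close>. Reversing the ordering on one jump must change the
  sign of an element of \<open>F\<close>, so there are only finitely many jumps. Since the orderings of a
  torsion-free abelian group of rank at least two are never isolated, each jump has rank one and the
  quotient over two consecutive jumps is not abelian. For any other \<open>\<C>\<close>-ordering \<open>P1\<close>, this
  noncommutativity forces the convex subgroups of \<open>P1\<close> to follow those of \<open>P\<close>, and then \<open>P1\<close> is
  determined by its signs on \<open>F\<close>. So the existence of an isolated \<open>\<C>\<close>-ordering makes their number
  finite. If no \<open>\<C>\<close>-ordering is isolated, then the space of \<open>\<C>\<close>-orderings, being nonempty and compact,
  is uncountable.\<close>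

section \<open>Convex subgroups\<close>

text \<open>The obstacle is that a competing cone \<open>P1\<close> has its own convex subgroups,
  possibly infinitely many, about which isolation of \<open>P\<close> says nothing directly. What
  carries over is algebra: commutators of a \<open>P1\<close>-jump fall into its lower subgroup, and
  the convex subgroups of any cone are closed under roots. Rank one of a \<open>P\<close>-jump is
  therefore used in the purely group-theoretic form \<open>y^k = c^m z\<close> with \<open>z\<close>
  in the lower subgroup: if \<open>c\<close> and \<open>z\<close> lie in some
  \<open>P1\<close>-convex subgroup, then so does \<open>y\<close>.

  Noncommutativity over two neighbouring jumps comes from isolation once more. An abelian quotient
  would have rank one, yet it contains the lower jump as a proper nontrivial root-closed subgroup.

  Compactness meets a different difficulty: the exponent in the Conrad condition is unbounded. Given
  the other cone axioms, the condition is equivalent to its instance with exponent two, which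
  involves only three memberships.\<close>

context group
begin

lemma inv_mult_cancel [simp]: "\<lbrakk>x \<in> carrier G; y \<in> carrier G\<rbrakk> \<Longrightarrow> inv x \<otimes> (x \<otimes> y) = y"
  by (simp add: m_assoc[symmetric])

lemma mult_inv_cancel [simp]: "\<lbrakk>x \<in> carrier G; y \<in> carrier G\<rbrakk> \<Longrightarrow> x \<otimes> (inv x \<otimes> y) = y"
  by (simp add: m_assoc[symmetric])

lemma int_pow_in_subgroup:
  assumes H: "subgroup H G" and x: "x \<in> H"
  shows "x [^] (n::int) \<in> H"
proof -
  interpret H: group "G\<lparr>carrier := H\<rparr>" using subgroup.subgroup_is_group[OF H] group_axioms by blast
  show ?thesis using H.int_pow_closed[of x n] x int_pow_consistent[OF H x] by simp
qed

end

locale ccone = group G for G (structure) +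
  fixes P :: "'a set"
  assumes P_sub: "P \<subseteq> carrier G"
    and one_notin_P: "\<one> \<notin> P"
    and P_mult: "\<lbrakk>x \<in> P; y \<in> P\<rbrakk> \<Longrightarrow> x \<otimes> y \<in> P"
    and P_total: "\<lbrakk>x \<in> carrier G; x \<noteq> \<one>\<rbrakk> \<Longrightarrow> x \<in> P \<or> inv x \<in> P"
    and P_conrad: "\<lbrakk>f \<in> P; g \<in> P\<rbrakk> \<Longrightarrow> \<exists>n\<ge>1::nat. inv g \<otimes> (f \<otimes> g [^] n) \<in> P"
begin

lemma P_carrier [simp]: "x \<in> P \<Longrightarrow> x \<in> carrier G"
  using P_sub by blast

lemma inv_notin_P: "x \<in> P \<Longrightarrow> inv x \<notin> P"
  using P_mult[of x "inv x"] one_notin_P by auto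

lemma P_pow:
  assumes "x \<in> P" "n \<ge> 1"
  shows "x [^] (n::nat) \<in> P"
  using assms(2,1)
proof (induction n rule: dec_induct)
  case base then show ?case by simp
next
  case (step n) then show ?case by (auto intro: P_mult)
qed

text \<open>Testing intervals that start at \<open>\<one>\<close> is enough: left translation by
  elements of \<open>H\<close> reaches all others.\<close>

definition convex :: "'a set \<Rightarrow> bool" where
  "convex H \<longleftrightarrow> subgroup H G \<and> (\<forall>x\<in>P. \<forall>h\<in>H. inv x \<otimes> h \<in> P \<longrightarrow> x \<in> H)"

lemma convex_subgroup: "convex H \<Longrightarrow> subgroup H G"
  by (simp add: convex_def)

lemma convexD: "\<lbrakk>convex H; x \<in> P; h \<in> H; inv x \<otimes> h \<in> P\<rbrakk> \<Longrightarrow> x \<in> H"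
  by (auto simp: convex_def)

lemma convex_carrier [simp]: "convex (carrier G)"
  by (auto simp: convex_def subgroup_self)

lemma convex_one [simp]: "convex {\<one>}"
  using inv_notin_P by (auto simp: convex_def triv_subgroup)

lemma subgroup_mult_iff:
  assumes "subgroup H G" "h \<in> H" "x \<in> carrier G"
  shows "x \<otimes> h \<in> H \<longleftrightarrow> x \<in> H" "h \<otimes> x \<in> H \<longleftrightarrow> x \<in> H"
proof -
  interpret H: subgroup H G by fact
  have hc: "h \<in> carrier G" using assms H.mem_carrier by blast
  have "x = (x \<otimes> h) \<otimes> inv h" "x = inv h \<otimes> (h \<otimes> x)"
    using assms hc by (simp_all add: m_assoc)
  then show "x \<otimes> h \<in> H \<longleftrightarrow> x \<in> H" "h \<otimes> x \<in> H \<longleftrightarrow> x \<in> H"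
    using H.m_closed H.m_inv_closed assms by metis+
qed

lemma subgroup_inv_iff:
  assumes "subgroup H G" "x \<in> carrier G"
  shows "inv x \<in> H \<longleftrightarrow> x \<in> H"
  using assms subgroup.m_inv_closed inv_inv by metis

text \<open>If \<open>x \<otimes> h\<close> were negative, its inverse would lie between
  \<open>\<one>\<close> and \<open>inv h\<close>, hence in \<open>H\<close>. Signs outside a convex
  subgroup are thus constant on cosets.\<close>

lemma outside_mult_right:
  assumes H: "convex H" and x: "x \<in> P" "x \<notin> H" and h: "h \<in> H"
  shows "x \<otimes> h \<in> P"
proof (rule ccontr)
  assume n: "x \<otimes> h \<notin> P"
  note sg = convex_subgroup[OF H]
  have hc: "h \<in> carrier G" using h sg subgroup.mem_carrier by metis
  have ni: "x \<otimes> h \<notin> H" using subgroup_mult_iff[OF sg h] x by simp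
  then have "x \<otimes> h \<noteq> \<one>" using subgroup.one_closed[OF sg] by metis
  then have y: "inv (x \<otimes> h) \<in> P" using n P_total[of "x \<otimes> h"] x hc by simp
  have "inv (inv (x \<otimes> h)) \<otimes> inv h = x" using x hc by (simp add: m_assoc)
  then have "inv (x \<otimes> h) \<in> H"
    using convexD[OF H y, of "inv h"] x h subgroup.m_inv_closed[OF sg] by metis
  then show False using ni subgroup_inv_iff[OF sg] x hc by simp
qed

text \<open>A negative \<open>h \<otimes> x\<close> gives \<open>\<one> < x < inv h\<close>. The two
  kinds of cosets are treated separately because \<open>H\<close> need not be normal.\<close>

lemma outside_mult_left:
  assumes H: "convex H" and x: "x \<in> P" "x \<notin> H" and h: "h \<in> H"
  shows "h \<otimes> x \<in> P"
proof (rule ccontr)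
  assume n: "h \<otimes> x \<notin> P"
  note sg = convex_subgroup[OF H]
  have hc: "h \<in> carrier G" using h sg subgroup.mem_carrier by metis
  have ni: "h \<otimes> x \<notin> H" using subgroup_mult_iff[OF sg h] x by simp
  then have "h \<otimes> x \<noteq> \<one>" using subgroup.one_closed[OF sg] by metis
  then have "inv (h \<otimes> x) \<in> P" using n P_total[of "h \<otimes> x"] x hc by simp
  then have "inv x \<otimes> inv h \<in> P" using x hc by (simp add: inv_mult_group)
  then have "x \<in> H"
    using convexD[OF H x(1), of "inv h"] h subgroup.m_inv_closed[OF sg] by metis
  then show False using x by simp
qed

text \<open>The smaller of \<open>x\<close> and \<open>y\<close> lies between \<open>\<one>\<close>
  and the other, hence in the other's subgroup.\<close>

lemma convex_chain_aux:
  assumes "convex H" "convex K" "x \<in> H" "x \<notin> K" "x \<in> P" "y \<in> K" "y \<notin> H" "y \<in> P"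
  shows False
proof -
  have "inv x \<otimes> y \<noteq> \<one>"
  proof
    assume "inv x \<otimes> y = \<one>"
    then have "x \<otimes> (inv x \<otimes> y) = x" using assms by simp
    then show False using assms by simp
  qed
  then have "inv x \<otimes> y \<in> P \<or> inv (inv x \<otimes> y) \<in> P"
    using assms by (intro P_total) auto
  then have "inv x \<otimes> y \<in> P \<or> inv y \<otimes> x \<in> P" using assms by (simp add: inv_mult_group)
  then show False using convexD assms by metis
qed

lemma outside_pos:
  assumes "subgroup H G" "x \<notin> H" "x \<in> carrier G"
  obtains "x \<in> P" | "inv x \<in> P" "inv x \<notin> H"
proof -
  have "x \<noteq> \<one>" using assms subgroup.one_closed by blast
  then show ?thesis using that P_total[of x] assms subgroup_inv_iff[of H x] by blast
qed

lemma convex_chain: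
  assumes "convex H" "convex K"
  shows "H \<subseteq> K \<or> K \<subseteq> H"
proof (rule ccontr)
  assume "\<not> ?thesis"
  then obtain x y where xy: "x \<in> H" "x \<notin> K" "y \<in> K" "y \<notin> H" by blast
  note s = convex_subgroup[OF assms(1)] convex_subgroup[OF assms(2)]
  have c: "x \<in> carrier G" "y \<in> carrier G"
    using xy s subgroup.mem_carrier by metis+
  have "\<exists>x'\<in>H - K. x' \<in> P"
    using outside_pos[OF s(2) xy(2) c(1)] xy subgroup.m_inv_closed[OF s(1)] by (metis DiffI)
  moreover have "\<exists>y'\<in>K - H. y' \<in> P"
    using outside_pos[OF s(1) xy(4) c(2)] xy subgroup.m_inv_closed[OF s(2)] by (metis DiffI)
  ultimately show False using convex_chain_aux[OF assms] by blast
qed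

text \<open>A positive \<open>y\<close> satisfies \<open>y \<le> y^n\<close>, so convexity pulls it
  into \<open>H\<close>. This makes quotients by convex subgroups torsion-free.\<close>

lemma convex_pow_iff:
  assumes H: "convex H" and x: "x \<in> carrier G" and n: "n \<ge> (1::nat)"
  shows "x [^] n \<in> H \<longleftrightarrow> x \<in> H"
proof -
  note sg = convex_subgroup[OF H]
  have pos: "y \<in> H" if "y \<in> P" "y [^] n \<in> H" for y
  proof (cases "n = 1")
    case True then show ?thesis using that by simp
  next
    case False
    then have "y [^] (n - 1) \<in> P" using n that by (intro P_pow) auto
    moreover have "y [^] n = y \<otimes> y [^] (n - 1)"
      using n that nat_pow_Suc2[of y "n-1"] by simp
    ultimately have "inv y \<otimes> y [^] n \<in> P" using that by simp
    then show ?thesis using convexD[OF H] that by blast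
  qed
  show ?thesis
  proof
    assume xn: "x [^] n \<in> H"
    show "x \<in> H"
    proof (rule ccontr)
      assume "x \<notin> H"
      then show False
      proof (cases rule: outside_pos[OF sg _ x])
        case 3
        have "inv x [^] n \<in> H"
          using xn x subgroup.m_inv_closed[OF sg] by (simp add: nat_pow_inv)
        then show ?thesis using pos 3 by blast
      qed (use pos xn \<open>x \<notin> H\<close> in auto)
    qed
  next
    assume "x \<in> H"
    then show "x [^] n \<in> H"
      by (induction n) (auto intro: subgroup.m_closed[OF sg] subgroup.one_closed[OF sg])
  qed
qed

end

section \<open>Convex jumps and cofinality of powers\<close>

context ccone
begin

text \<open>The convex jump of \<open>g\<close>, usually written \<open>G\<^sub>g \<subset> G\<^sup>g\<close>.\<close>

definition jump_top :: "'a \<Rightarrow> 'a set" where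
  "jump_top g = \<Inter>{H. convex H \<and> g \<in> H}"

definition jump_bot :: "'a \<Rightarrow> 'a set" where
  "jump_bot g = \<Union>{H. convex H \<and> g \<notin> H}"

lemma jump_top_least: "\<lbrakk>convex H; g \<in> H\<rbrakk> \<Longrightarrow> jump_top g \<subseteq> H"
  by (auto simp: jump_top_def)

lemma jump_bot_greatest: "\<lbrakk>convex H; g \<notin> H\<rbrakk> \<Longrightarrow> H \<subseteq> jump_bot g"
  by (auto simp: jump_bot_def)

lemma self_in_jump_top: "g \<in> jump_top g"
  by (auto simp: jump_top_def)

lemma self_notin_jump_bot: "g \<notin> jump_bot g"
  by (auto simp: jump_bot_def)

lemma convex_jump_top:
  assumes "g \<in> carrier G" shows "convex (jump_top g)"
proof -
  have "subgroup (jump_top g) G" unfolding jump_top_def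
    by (rule subgroups_Inter) (use assms convex_carrier convex_subgroup in blast)+
  then show ?thesis
    by (auto simp: convex_def jump_top_def)
qed

lemma convex_jump_bot:
  assumes "g \<in> carrier G" "g \<noteq> \<one>" shows "convex (jump_bot g)"
proof -
  have one: "\<one> \<in> jump_bot g" using jump_bot_greatest[OF convex_one] assms by auto
  have "subgroup (jump_bot g) G"
  proof
    show "jump_bot g \<subseteq> carrier G"
      using subgroup.mem_carrier[OF convex_subgroup] by (auto simp: jump_bot_def)
    fix x y assume "x \<in> jump_bot g" "y \<in> jump_bot g"
    then obtain H K where HK: "convex H" "x \<in> H" "g \<notin> H" "convex K" "y \<in> K" "g \<notin> K"
      by (auto simp: jump_bot_def)
    then consider "x \<in> K" | "y \<in> H" using convex_chain by blast
    then show "x \<otimes> y \<in> jump_bot g"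
    proof cases
      case 1 then show ?thesis
        using subgroup.m_closed[OF convex_subgroup[OF HK(4)] _ HK(5)] jump_bot_greatest[OF HK(4,6)] by blast
    next
      case 2 then show ?thesis
        using subgroup.m_closed[OF convex_subgroup[OF HK(1)] HK(2)] jump_bot_greatest[OF HK(1,3)] by blast
    qed
  next
    fix x assume "x \<in> jump_bot g"
    then obtain H where H: "convex H" "x \<in> H" "g \<notin> H" by (auto simp: jump_bot_def)
    show "inv x \<in> jump_bot g"
      using subgroup.m_inv_closed[OF convex_subgroup[OF H(1)] H(2)] jump_bot_greatest[OF H(1,3)] by blast
  qed (rule one)
  then show ?thesis
    by (auto simp: convex_def jump_bot_def)
qed

lemma jump_bot_subset_jump_top:
  assumes "g \<in> carrier G"
  shows "jump_bot g \<subseteq> jump_top g"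
  using convex_chain[OF convex_jump_top[OF assms]] self_in_jump_top by (force simp: jump_bot_def)

lemma jump_eq:
  assumes "g \<in> carrier G" "a \<in> jump_top g" "a \<notin> jump_bot g"
  shows "jump_top a = jump_top g" "jump_bot a = jump_bot g"
proof -
  have a: "a \<in> carrier G"
    using subgroup.mem_carrier[OF convex_subgroup[OF convex_jump_top[OF assms(1)]] assms(2)] .
  have 1: "jump_top a \<subseteq> jump_top g"
    using jump_top_least[OF convex_jump_top[OF assms(1)] assms(2)] .
  have 2: "g \<in> jump_top a"
    using jump_bot_greatest[OF convex_jump_top[OF a], of g] self_in_jump_top[of a] assms(3) by blast
  show "jump_top a = jump_top g"
    using 1 jump_top_least[OF convex_jump_top[OF a] 2] by blast
  have "a \<in> H \<longleftrightarrow> g \<in> H" if "convex H" for H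
    using jump_top_least[OF that] 2 assms(2) by blast
  then show "jump_bot a = jump_bot g" unfolding jump_bot_def by (intro arg_cong[where f=Union]) blast
qed

text \<open>From \<open>h < a^m\<close> and \<open>k < a^n\<close> left invariance yields only
  \<open>h k < h a^n\<close>. The Conrad property for \<open>inv h \<otimes> a^m\<close> and
  \<open>a^n\<close> supplies \<open>h a^n < a^(m + n N)\<close>.\<close>

lemma bounded_mult:
  assumes a: "a \<in> P" and h: "h \<in> carrier G" "inv h \<otimes> a [^] (m::nat) \<in> P"
    and k: "k \<in> carrier G" "inv k \<otimes> a [^] (n::nat) \<in> P" "n \<ge> 1"
  shows "\<exists>N\<ge>1::nat. inv (h \<otimes> k) \<otimes> a [^] N \<in> P"
proof -
  have ac: "a \<in> carrier G" using a by simp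
  obtain N where N: "N \<ge> 1" "inv (a [^] n) \<otimes> ((inv h \<otimes> a [^] m) \<otimes> (a [^] n) [^] (N::nat)) \<in> P"
    using P_conrad[OF h(2) P_pow[OF a k(3)]] by auto
  have "(inv k \<otimes> a [^] n) \<otimes> (inv (a [^] n) \<otimes> ((inv h \<otimes> a [^] m) \<otimes> (a [^] n) [^] (N::nat))) \<in> P"
    using P_mult k(2) N(2) by blast
  also have "(inv k \<otimes> a [^] n) \<otimes> (inv (a [^] n) \<otimes> ((inv h \<otimes> a [^] m) \<otimes> (a [^] n) [^] (N::nat)))
      = inv (h \<otimes> k) \<otimes> a [^] (m + n * N)"
    using ac h(1) k(1) by (simp add: m_assoc inv_mult_group nat_pow_mult[symmetric] nat_pow_pow)
  finally show ?thesis using k(3) N(1) by (intro exI[of _ "m + n * N"] conjI) (auto simp: trans_le_add2)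
qed

text \<open>The elements that are, like their inverses, bounded by powers of \<open>a\<close> form a
  convex subgroup containing \<open>a\<close>, hence containing \<open>jump_top a\<close>.\<close>

lemma jump_top_bounded:
  assumes a: "a \<in> P" and x: "x \<in> jump_top a"
  shows "\<exists>n\<ge>1::nat. inv x \<otimes> a [^] n \<in> P"
proof -
  define L where "L = {h \<in> carrier G. \<exists>n\<ge>1::nat. inv h \<otimes> a [^] n \<in> P}"
  define M where "M = {h \<in> L. inv h \<in> L}"
  have ac: "a \<in> carrier G" using a by simp
  have Lm: "h \<otimes> k \<in> L" if "h \<in> L" "k \<in> L" for h k
    using that bounded_mult[OF a] unfolding L_def by blast
  have La: "a \<in> L" unfolding L_def
    using a by (auto intro!: exI[of _ 2] simp: numeral_2_eq_2 m_assoc)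
  have Linv: "inv y \<in> L" if "y \<in> P" for y unfolding L_def
    using that P_mult[OF that a] a by (auto intro!: exI[of _ 1])
  have L1: "\<one> \<in> L" unfolding L_def using a by (auto intro!: exI[of _ 1])
  have Lc: "L \<subseteq> carrier G" by (auto simp: L_def)
  have "subgroup M G"
    by (rule subgroup.intro) (use Lm Lc L1 in \<open>auto simp: M_def inv_mult_group subset_iff\<close>)
  moreover have "y \<in> M" if "y \<in> P" "h \<in> M" "inv y \<otimes> h \<in> P" for y h
  proof -
    have hL: "h \<in> L" and hc: "h \<in> carrier G" using that Lc by (auto simp: M_def)
    obtain n where n: "n \<ge> 1" "inv h \<otimes> a [^] (n::nat) \<in> P" using hL by (auto simp: L_def)
    have "(inv y \<otimes> h) \<otimes> (inv h \<otimes> a [^] n) \<in> P" using P_mult that n by blast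
    then have "inv y \<otimes> a [^] n \<in> P" using that hc ac by (simp add: m_assoc)
    then have "y \<in> L" using n that unfolding L_def by auto
    then show ?thesis using Linv[OF that(1)] by (simp add: M_def)
  qed
  ultimately have "convex M" unfolding convex_def by blast
  then have "jump_top a \<subseteq> M" using jump_top_least La Linv[OF a] by (simp add: M_def)
  then show ?thesis using x by (auto simp: M_def L_def)
qed

end

section \<open>Conjugation inside one convex jump\<close>

locale cjump = ccone +
  fixes g
  assumes g_carrier: "g \<in> carrier G" and g_not_one: "g \<noteq> \<one>"
begin

abbreviation "A \<equiv> jump_top g"
abbreviation "B \<equiv> jump_bot g"

text \<open>The positive cone that the quotient of \<open>A\<close> by \<open>B\<close> is going to
  carry, pulled back to \<open>A\<close>. Normality of \<open>B\<close> in \<open>A\<close> is not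
  yet known, so the argument stays with elements of \<open>A\<close>.\<close>

definition Q where "Q = {x \<in> P. x \<in> A \<and> x \<notin> B}"

lemma A_convex: "convex A" and B_convex: "convex B"
  using convex_jump_top convex_jump_bot g_carrier g_not_one by auto

lemma A_subgroup: "subgroup A G" and B_subgroup: "subgroup B G"
  using convex_subgroup A_convex B_convex by auto

lemma A_carrier [simp]: "x \<in> A \<Longrightarrow> x \<in> carrier G"
  and B_carrier [simp]: "x \<in> B \<Longrightarrow> x \<in> carrier G"
  using A_subgroup B_subgroup subgroup.mem_carrier by metis+

lemma A_m [intro, simp]: "\<lbrakk>x \<in> A; y \<in> A\<rbrakk> \<Longrightarrow> x \<otimes> y \<in> A"
  and A_inv [intro, simp]: "x \<in> A \<Longrightarrow> inv x \<in> A"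
  and B_m [intro, simp]: "\<lbrakk>x \<in> B; y \<in> B\<rbrakk> \<Longrightarrow> x \<otimes> y \<in> B"
  and B_inv [intro, simp]: "x \<in> B \<Longrightarrow> inv x \<in> B"
  and A_one [simp]: "\<one> \<in> A"
  and B_one [simp]: "\<one> \<in> B"
  using A_subgroup B_subgroup
  by (auto intro: subgroup.m_closed subgroup.m_inv_closed subgroup.one_closed)

lemma A_pow [intro, simp]: "x \<in> A \<Longrightarrow> x [^] (n::nat) \<in> A"
  and B_pow [intro, simp]: "x \<in> B \<Longrightarrow> x [^] (n::nat) \<in> B"
  by (induction n) auto

lemma B_A: "x \<in> B \<Longrightarrow> x \<in> A"
  using jump_bot_subset_jump_top[OF g_carrier] by auto

lemma Q_P: "x \<in> Q \<Longrightarrow> x \<in> P" and Q_A [simp]: "x \<in> Q \<Longrightarrow> x \<in> A" and Q_B: "x \<in> Q \<Longrightarrow> x \<notin> B"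
  and QI: "\<lbrakk>x \<in> P; x \<in> A; x \<notin> B\<rbrakk> \<Longrightarrow> x \<in> Q"
  by (auto simp: Q_def)

lemma Q_carrier [simp]: "x \<in> Q \<Longrightarrow> x \<in> carrier G"
  by (simp add: Q_P)

lemma Q_cases:
  assumes "x \<in> A"
  obtains "x \<in> Q" | "inv x \<in> Q" | "x \<in> B"
  using assms outside_pos[OF B_subgroup, of x] A_carrier[OF assms] QI A_inv by metis

lemma Q_mult_B: "\<lbrakk>x \<in> Q; b \<in> B\<rbrakk> \<Longrightarrow> x \<otimes> b \<in> Q"
  using outside_mult_right[OF B_convex] subgroup_mult_iff[OF B_subgroup]
  by (auto intro!: QI simp: Q_P Q_B B_A)

lemma B_mult_Q: "\<lbrakk>x \<in> Q; b \<in> B\<rbrakk> \<Longrightarrow> b \<otimes> x \<in> Q"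
  using outside_mult_left[OF B_convex] subgroup_mult_iff[OF B_subgroup]
  by (auto intro!: QI simp: Q_P Q_B B_A)

lemma Q_mult:
  assumes "x \<in> Q" "y \<in> Q" shows "x \<otimes> y \<in> Q"
proof (rule QI)
  show "x \<otimes> y \<in> P" using assms P_mult Q_P by blast
  then show "x \<otimes> y \<notin> B"
    using convexD[OF B_convex Q_P[OF assms(1)], of "x \<otimes> y"] assms Q_B[OF assms(1)] Q_P[OF assms(2)] by auto
qed (use assms in auto)

lemma Q_inv: "x \<in> Q \<Longrightarrow> inv x \<notin> Q"
  using inv_notin_P Q_P by blast

text \<open>Every \<open>q \<in> Q\<close> has the same jump as \<open>g\<close>, so its powers are
  cofinal in all of \<open>A\<close>.\<close>

lemma Q_archimedean:
  assumes "q \<in> Q" "x \<in> A"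
  shows "\<exists>n\<ge>1::nat. inv x \<otimes> q [^] n \<in> P"
  using jump_top_bounded[OF Q_P] jump_eq(1)[OF g_carrier] assms Q_A Q_B by metis

text \<open>Otherwise \<open>f\<^sup>n a < a\<close> for all \<open>n\<close>, so that the powers of \<open>f\<close> are bounded by \<open>a\<close>.\<close>

lemma no_contraction:
  assumes f: "f \<in> Q" and a: "a \<in> A" "a \<in> P"
  shows "inv (f \<otimes> a) \<otimes> a \<notin> P"
proof
  assume *: "inv (f \<otimes> a) \<otimes> a \<in> P"
  have fc: "f \<in> carrier G" and ac: "a \<in> carrier G" using f a by auto
  have n: "inv (f [^] n \<otimes> a) \<otimes> a \<in> P" if "n \<ge> 1" for n :: nat
    using that
  proof (induction n rule: dec_induct)
    case base then show ?case using * fc by simp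
  next
    case (step n)
    have "(inv (f \<otimes> a) \<otimes> a) \<otimes> (inv (f [^] n \<otimes> a) \<otimes> a) \<in> P"
      using P_mult[OF * step.IH] .
    then show ?case using fc ac by (simp add: inv_mult_group m_assoc)
  qed
  obtain N where N: "N \<ge> 1" "inv a \<otimes> f [^] (N::nat) \<in> P" using Q_archimedean[OF f a(1)] by auto
  have "(inv a \<otimes> f [^] N) \<otimes> a \<otimes> (inv (f [^] N \<otimes> a) \<otimes> a) \<in> P"
    using P_mult[OF P_mult[OF N(2) a(2)] n[OF N(1)]] .
  then show False using fc ac one_notin_P by (simp add: inv_mult_group m_assoc)
qed

text \<open>The conjugate \<open>c\<close> satisfies \<open>f^n a = a c^n\<close>. If
  \<open>inv c \<in> Q\<close>, then \<open>f a < a\<close>, which \<open>no_contraction\<close>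
  excludes. If \<open>c \<in> B\<close>, choosing \<open>f^N > a^2\<close> gives
  \<open>a < c^N\<close>, forcing \<open>a \<in> B\<close> and with it
  \<open>f \<in> B\<close>.\<close>

lemma Q_conj_pos:
  assumes f: "f \<in> Q" and a: "a \<in> A" "a \<in> P"
  shows "inv a \<otimes> (f \<otimes> a) \<in> Q"
proof -
  have fc: "f \<in> carrier G" and ac: "a \<in> carrier G" using f a by auto
  define c where "c = inv a \<otimes> (f \<otimes> a)"
  have cA: "c \<in> A" using f a by (auto simp: c_def)
  then have cc: "c \<in> carrier G" by simp
  have ic: "inv c = inv (f \<otimes> a) \<otimes> a" using fc ac by (simp add: c_def inv_mult_group m_assoc)
  have pw: "f [^] n \<otimes> a = a \<otimes> c [^] n" for n :: nat
  proof (induction n)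
    case (Suc n)
    have "f [^] Suc n \<otimes> a = f [^] n \<otimes> a \<otimes> c" using fc ac by (simp add: c_def m_assoc)
    also have "\<dots> = a \<otimes> c [^] Suc n" using ac cc by (simp add: Suc.IH m_assoc)
    finally show ?case .
  qed (use fc ac in simp)
  show ?thesis
  proof (cases rule: Q_cases[OF cA])
    case 1 then show ?thesis by (simp add: c_def)
  next
    case 2 then show ?thesis using no_contraction[OF f a] ic Q_P by auto
  next
    case 3
    have aB: "a \<notin> B"
    proof
      assume "a \<in> B"
      then have "a \<otimes> (c \<otimes> inv a) \<in> B" using 3 by auto
      then show False using f Q_B fc ac by (simp add: c_def m_assoc)
    qed
    obtain N where N: "N \<ge> 1" "inv (a \<otimes> a) \<otimes> f [^] (N::nat) \<in> P"
      using Q_archimedean[OF f, of "a \<otimes> a"] a by auto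
    have "inv (c [^] N) \<otimes> a \<in> P"
      using outside_mult_left[OF B_convex a(2) aB, of "inv (c [^] N)"] 3 by auto
    then have "(inv (a \<otimes> a) \<otimes> f [^] N) \<otimes> a \<otimes> (inv (c [^] N) \<otimes> a) \<in> P"
      using P_mult[OF P_mult[OF N(2) a(2)]] by blast
    also have "(inv (a \<otimes> a) \<otimes> f [^] N) \<otimes> a \<otimes> (inv (c [^] N) \<otimes> a)
       = inv (a \<otimes> a) \<otimes> ((f [^] N \<otimes> a) \<otimes> (inv (c [^] N) \<otimes> a))"
      using ac fc cc by (simp add: m_assoc)
    also have "\<dots> = \<one>" unfolding pw using ac cc by (simp add: m_assoc inv_mult_group)
    finally show ?thesis using one_notin_P by simp
  qed
qed

text \<open>If the inverse of the conjugate \<open>c\<close> is in \<open>Q\<close>, conjugating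
  back by \<open>Q_conj_pos\<close> gives \<open>inv f \<in> Q\<close>. The case
  \<open>c \<in> B\<close> is reduced to \<open>no_contraction\<close> for an element that differs
  from \<open>a\<close> by a factor in \<open>B\<close>.\<close>

lemma Q_conj_neg:
  assumes f: "f \<in> Q" and a: "a \<in> A" "a \<in> P"
  shows "a \<otimes> (f \<otimes> inv a) \<in> Q"
proof -
  have fc: "f \<in> carrier G" and ac: "a \<in> carrier G" using f a by auto
  define c where "c = a \<otimes> (f \<otimes> inv a)"
  have cA: "c \<in> A" using f a by (auto simp: c_def)
  then have cc: "c \<in> carrier G" by simp
  have f_c: "f = inv a \<otimes> (c \<otimes> a)" using fc ac by (simp add: c_def m_assoc)
  show ?thesis
  proof (cases rule: Q_cases[OF cA])
    case 1 then show ?thesis by (simp add: c_def)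
  next
    case 2
    have "inv a \<otimes> (inv c \<otimes> a) = inv f" using fc ac by (simp add: c_def m_assoc inv_mult_group)
    then show ?thesis using Q_conj_pos[OF 2 a] f Q_inv by auto
  next
    case 3
    have aB: "a \<notin> B"
    proof
      assume "a \<in> B"
      then have "inv a \<otimes> (c \<otimes> a) \<in> B" using 3 by auto
      then show False using f Q_B f_c by simp
    qed
    have pw: "a \<otimes> f [^] n = c [^] n \<otimes> a" for n :: nat
    proof (induction n)
      case (Suc n)
      have "a \<otimes> f [^] Suc n = (a \<otimes> f [^] n) \<otimes> f" using fc ac by (simp add: m_assoc)
      also have "\<dots> = c [^] n \<otimes> (a \<otimes> f)" using ac cc fc by (simp add: Suc.IH m_assoc)
      also have "a \<otimes> f = c \<otimes> a" using ac fc by (simp add: c_def m_assoc)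
      finally show ?case using ac cc by (simp add: m_assoc)
    qed (use fc ac in simp)
    obtain N where N: "N \<ge> 1" "inv a \<otimes> f [^] (N::nat) \<in> P"
      using Q_archimedean[OF f a(1)] by auto
    \<comment> \<open>Since \<open>a f^N = c^N a\<close>, the inequality \<open>e a < a\<close>
      unwinds to \<open>a < f^N\<close>, which holds by the choice of \<open>N\<close>.\<close>
    define e where "e = inv (c [^] N) \<otimes> a"
    have e: "e \<in> Q" unfolding e_def
      using B_mult_Q[OF QI[OF a(2,1) aB], of "inv (c [^] N)"] 3 by auto
    have "inv (e \<otimes> a) \<otimes> a = inv a \<otimes> (inv a \<otimes> (c [^] N \<otimes> a))"
      using ac cc by (simp add: e_def m_assoc inv_mult_group)
    also have "\<dots> = inv a \<otimes> f [^] N" using ac fc by (simp add: pw[symmetric])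
    finally have "inv (e \<otimes> a) \<otimes> a \<in> P" using N by simp
    then show ?thesis using no_contraction[OF e a] by simp
  qed
qed

text \<open>This yields invariance of the quotient order under right multiplication, which the
  Hoelder argument requires and the order on \<open>G\<close> itself need not have.\<close>

lemma Q_conj:
  assumes f: "f \<in> Q" and a: "a \<in> A"
  shows "inv a \<otimes> (f \<otimes> a) \<in> Q"
proof (cases "a = \<one>")
  case True then show ?thesis using f by simp
next
  case False
  then consider "a \<in> P" | "inv a \<in> P" using P_total[of a] a by auto
  then show ?thesis
  proof cases
    case 1 then show ?thesis using Q_conj_pos f a by blast
  next
    case 2 then show ?thesis using Q_conj_neg[OF f A_inv[OF a] 2] a by simp
  qed
qed

section \<open>The order on the quotient over a jump and Hoelder's argument\<close>

definition le where "le x y \<longleftrightarrow> inv x \<otimes> y \<in> Q \<union> B"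
definition less where "less x y \<longleftrightarrow> inv x \<otimes> y \<in> Q"

lemma less_le: "less x y \<Longrightarrow> le x y"
  by (simp add: le_def less_def)

text \<open>Totality comes from the trichotomy \<open>Q_cases\<close>; antisymmetry holds only up to
  \<open>B\<close>, as elements of one coset are below each other both ways.\<close>

lemma not_le:
  assumes "x \<in> A" "y \<in> A"
  shows "le x y \<longleftrightarrow> \<not> less y x"
proof -
  have i: "inv (inv x \<otimes> y) = inv y \<otimes> x" using assms by (simp add: inv_mult_group)
  have "inv x \<otimes> y \<in> A" using assms by simp
  then show ?thesis
  proof (cases rule: Q_cases)
    case 1 then show ?thesis using Q_inv i by (metis le_def less_def UnI1)
  next
    case 2 then show ?thesis using Q_inv i Q_B B_inv by (metis le_def less_def UnE inv_inv A_carrier assms A_m A_inv)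
  next
    case 3 then show ?thesis using i Q_B B_inv by (metis le_def less_def UnI2)
  qed
qed

lemma N_mult:
  assumes "x \<in> Q \<union> B" "y \<in> Q \<union> B" shows "x \<otimes> y \<in> Q \<union> B"
  using assms Q_mult Q_mult_B B_mult_Q B_m by blast

lemma le_trans:
  assumes "x \<in> A" "y \<in> A" "z \<in> A" "le x y" "le y z" shows "le x z"
proof -
  have "(inv x \<otimes> y) \<otimes> (inv y \<otimes> z) \<in> Q \<union> B" using assms N_mult le_def by blast
  then show ?thesis using assms by (simp add: le_def m_assoc)
qed

lemma le_less_trans:
  assumes "x \<in> A" "y \<in> A" "z \<in> A" "le x y" "less y z" shows "less x z"
  using assms le_trans not_le by metis

lemma less_le_trans:
  assumes "x \<in> A" "y \<in> A" "z \<in> A" "less x y" "le y z" shows "less x z"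
  using assms le_trans not_le by metis

lemma less_mult_left:
  assumes "x \<in> A" "y \<in> A" "z \<in> A" shows "less (z \<otimes> x) (z \<otimes> y) \<longleftrightarrow> less x y"
  using assms by (simp add: less_def inv_mult_group m_assoc)

lemma less_mult_right_imp:
  assumes "x \<in> A" "y \<in> A" "z \<in> A" "less x y" shows "less (x \<otimes> z) (y \<otimes> z)"
  using assms Q_conj[of "inv x \<otimes> y" z] by (simp add: less_def inv_mult_group m_assoc)

lemma less_mult_right:
  assumes "x \<in> A" "y \<in> A" "z \<in> A"
  shows "less (x \<otimes> z) (y \<otimes> z) \<longleftrightarrow> less x y"
proof -
  have "less x y" if "less (x \<otimes> z) (y \<otimes> z)"
    using less_mult_right_imp[OF A_m[OF assms(1,3)] A_m[OF assms(2,3)] A_inv[OF assms(3)] that] assms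
    by (simp add: m_assoc)
  then show ?thesis using less_mult_right_imp[OF assms] by iprover
qed

lemma le_mult_left:
  assumes "x \<in> A" "y \<in> A" "z \<in> A" shows "le (z \<otimes> x) (z \<otimes> y) \<longleftrightarrow> le x y"
  using not_le[of "z \<otimes> x" "z \<otimes> y"] not_le[of x y] less_mult_left[of y x z] assms by simp

lemma le_mult_right:
  assumes "x \<in> A" "y \<in> A" "z \<in> A" shows "le (x \<otimes> z) (y \<otimes> z) \<longleftrightarrow> le x y"
  using not_le[of "x \<otimes> z" "y \<otimes> z"] not_le[of x y] less_mult_right[of y x z] assms by simp

lemma le_mult:
  assumes "x \<in> A" "y \<in> A" "x' \<in> A" "y' \<in> A" "le x y" "le x' y'"
  shows "le (x \<otimes> x') (y \<otimes> y')"
  by (rule le_trans[of _ "y \<otimes> x'"])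
    (use assms le_mult_left[of x' y' y] le_mult_right[of x y x'] in simp_all)

lemma less_mult:
  assumes "x \<in> A" "y \<in> A" "x' \<in> A" "y' \<in> A" "less x y" "less x' y'"
  shows "less (x \<otimes> x') (y \<otimes> y')"
  by (rule less_le_trans[of _ "y \<otimes> x'"])
    (use assms less_le[of x' y'] le_mult_left[of x' y' y] less_mult_right[of x y x'] in simp_all)

lemma less_one: "x \<in> A \<Longrightarrow> less \<one> x \<longleftrightarrow> x \<in> Q"
  by (simp add: less_def)

lemma A_int_pow [simp]: "x \<in> A \<Longrightarrow> x [^] (n::int) \<in> A"
  by (rule int_pow_in_subgroup[OF A_subgroup])

lemma floor_exists:
  assumes e: "e \<in> Q" and a: "a \<in> A"
  shows "\<exists>m::int. le (e [^] m) a \<and> less a (e [^] (m + 1))"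
proof -
  have ec: "e \<in> carrier G" and eA: "e \<in> A" using e by auto
  obtain n0 where n0: "n0 \<ge> 1" "inv (inv a) \<otimes> e [^] (n0::nat) \<in> P"
    using Q_archimedean[OF e A_inv[OF a]] by auto
  obtain n1 where n1: "n1 \<ge> 1" "inv a \<otimes> e [^] (n1::nat) \<in> P"
    using Q_archimedean[OF e a] by auto
  have PQ: "x \<in> Q \<union> B" if "x \<in> P" "x \<in> A" for x using that QI by blast
  have "a \<otimes> e [^] n0 \<in> Q \<union> B" using n0 a eA by (intro PQ) auto
  then have low: "le (e [^] (- int n0)) a"
  proof -
    have "le \<one> (a \<otimes> e [^] n0)"
      using \<open>a \<otimes> e [^] n0 \<in> Q \<union> B\<close> a eA by (simp add: le_def)
    then have "le (\<one> \<otimes> inv (e [^] n0)) ((a \<otimes> e [^] n0) \<otimes> inv (e [^] n0))"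
      using le_mult_right[of \<one> "a \<otimes> e [^] n0" "inv (e [^] n0)"] a eA by auto
    then show ?thesis using a ec by (simp add: m_assoc int_pow_neg_int)
  qed
  \<comment> \<open>The search runs upwards from the exponent \<open>- n0\<close>, so the offset
    \<open>n0 + n1 + 1\<close> stands for \<open>n1 + 1\<close>. The extra one makes the bound
    strict: a positive element of \<open>A\<close> may lie in \<open>B\<close>, so only
    \<open>le a (e^n1)\<close> is known.\<close>
  have hi: "\<not> le (e [^] (- int n0 + int (n0 + n1 + 1))) a"
  proof -
    have "le a (e [^] n1)" unfolding le_def by (rule PQ) (use n1 a eA in auto)
    moreover have "less (e [^] n1) (e [^] (n1 + 1))" using e ec by (simp add: less_def)
    ultimately have "less a (e [^] (n1 + 1))"
      by (intro le_less_trans[of a "e [^] n1"]) (use a eA in auto)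
    then have "\<not> le (e [^] (n1 + 1)) a" using not_le[of "e [^] (n1+1)" a] a eA by auto
    moreover have "e [^] (- int n0 + int (n0 + n1 + 1)) = e [^] (n1 + 1)"
      using int_pow_int[of G e "n1 + 1"] by (simp add: algebra_simps)
    ultimately show ?thesis by simp
  qed
  have "\<exists>k. (\<forall>i\<le>k. \<not> \<not> le (e [^] (- int n0 + int i)) a)
      \<and> \<not> le (e [^] (- int n0 + int (Suc k))) a"
    using ex_least_nat_less[of "\<lambda>k. \<not> le (e [^] (- int n0 + int k)) a", OF hi] low by auto
  then obtain k where k: "le (e [^] (- int n0 + int k)) a" "\<not> le (e [^] (- int n0 + int (Suc k))) a"
    by blast
  have "- int n0 + int (Suc k) = - int n0 + int k + 1" by simp
  then have "\<not> le (e [^] (- int n0 + int k + 1)) a" using k(2) by metis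
  then have "less a (e [^] (- int n0 + int k + 1))"
    using not_le[OF A_int_pow[OF eA] a] by blast
  then show ?thesis using k(1) by blast
qed

text \<open>The argument of Hoelder's theorem that Archimedean bi-ordered groups are abelian,
  modulo \<open>B\<close>.\<close>

lemma commutator_aux:
  assumes ab: "a \<in> A" "b \<in> A" and c: "c \<in> Q" "c \<otimes> (b \<otimes> a) = a \<otimes> b"
  shows False
proof -
  have cA: "c \<in> A" using c by simp
  \<comment> \<open>If \<open>e^2 \<le> c\<close>, bracketing \<open>a\<close> and \<open>b\<close>
    between consecutive powers of \<open>e\<close> gives
    \<open>a b < e^(m+n+2) \<le> c b a = a b\<close>.\<close>
  have no2: "\<not> le (e \<otimes> e) c" if e: "e \<in> Q" for e
  proof
    assume ee: "le (e \<otimes> e) c"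
    have ec: "e \<in> carrier G" and eA: "e \<in> A" using e by auto
    obtain m n where m: "le (e [^] (m::int)) a" "less a (e [^] (m + 1))"
      and n: "le (e [^] (n::int)) b" "less b (e [^] (n + 1))"
      using floor_exists[OF e] ab by meson
    have "less (a \<otimes> b) (e [^] (m + 1) \<otimes> e [^] (n + 1))"
      using ab m n eA by (intro less_mult) auto
    moreover have "le ((e \<otimes> e) \<otimes> (e [^] n \<otimes> e [^] m)) (c \<otimes> (b \<otimes> a))"
      using ab m n eA ee cA by (intro le_mult) auto
    moreover have "(e \<otimes> e) \<otimes> (e [^] n \<otimes> e [^] m) = e [^] (m + 1) \<otimes> e [^] (n + 1)"
    proof -
      have "e \<otimes> e = e [^] (1::int) \<otimes> e [^] (1::int)" using ec by simp
      then show ?thesis using ec by (simp only: int_pow_mult[symmetric]) (simp add: algebra_simps)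
    qed
    ultimately show False using not_le[of "e [^] (m + 1) \<otimes> e [^] (n + 1)" "a \<otimes> b"] c ab eA by auto
  qed
  \<comment> \<open>Hence \<open>c\<close> is least in \<open>Q\<close> up to \<open>B\<close>: a
    smaller \<open>f\<close> splits \<open>c\<close> as \<open>f h\<close>, and the smaller of the
    two factors has its square below \<open>c\<close>.\<close>
  have min: "le c f" if f: "f \<in> Q" for f
  proof (rule ccontr)
    assume "\<not> le c f"
    then have l: "less f c" using not_le[of c f] f cA by auto
    define h where "h = inv f \<otimes> c"
    have h: "h \<in> Q" using l by (simp add: h_def less_def)
    have fh: "f \<otimes> h = c" using f c by (simp add: h_def)
    consider "le f h" | "le h f" using not_le[of f h] f h less_le by auto
    then show False
    proof cases
      case 1
      then have "le (f \<otimes> f) (f \<otimes> h)" using le_mult_left f h by simp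
      then show False using no2[OF f] fh by simp
    next
      case 2
      then have "le (h \<otimes> h) (f \<otimes> h)" using le_mult_right f h by simp
      then show False using no2[OF h] fh by simp
    qed
  qed
  \<comment> \<open>With a least positive element the floor is exact: every \<open>x\<close> agrees
    with a power of \<open>c\<close> up to \<open>B\<close>, so \<open>a\<close> and
    \<open>b\<close> commute up to \<open>B\<close>.\<close>
  have flr: "\<exists>m::int. le (c [^] m) x \<and> le x (c [^] m)" if x: "x \<in> A" for x
  proof -
    obtain m where m: "le (c [^] (m::int)) x" "less x (c [^] (m + 1))"
      using floor_exists[OF c(1) x] by blast
    define u where "u = inv (c [^] m) \<otimes> x"
    have "u \<notin> Q"
    proof
      assume u: "u \<in> Q"
      then have "le (c [^] m \<otimes> c) (c [^] m \<otimes> u)" using le_mult_left[of c u "c [^] m"] min cA by simp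
      moreover have "c [^] m \<otimes> u = x" using x cA by (simp add: u_def)
      moreover have "c [^] m \<otimes> c = c [^] (m + 1)" using cA by (simp add: int_pow_mult)
      ultimately show False using m(2) not_le[of "c [^] (m + 1)" x] x cA by simp
    qed
    then have "\<not> less (c [^] m) x" by (simp add: less_def u_def)
    then show ?thesis using m not_le[of x "c [^] m"] x cA by auto
  qed
  obtain m n where m: "le (c [^] (m::int)) a" "le a (c [^] m)"
    and n: "le (c [^] (n::int)) b" "le b (c [^] n)"
    using flr ab by meson
  have "le (a \<otimes> b) (c [^] m \<otimes> c [^] n)" using m n ab cA by (intro le_mult) auto
  moreover have "le (c [^] n \<otimes> c [^] m) (b \<otimes> a)" using m n ab cA by (intro le_mult) auto
  moreover have "c [^] n \<otimes> c [^] m = c [^] m \<otimes> c [^] n"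
    using cA by (simp add: int_pow_mult[symmetric] add.commute)
  ultimately have "le (a \<otimes> b) (b \<otimes> a)" using le_trans[of "a \<otimes> b" "c [^] m \<otimes> c [^] n" "b \<otimes> a"] ab cA by auto
  moreover have "less (\<one> \<otimes> (b \<otimes> a)) (c \<otimes> (b \<otimes> a))"
    using less_mult_right[of \<one> c "b \<otimes> a"] less_one c ab cA by auto
  ultimately show False using not_le[of "a \<otimes> b" "b \<otimes> a"] c(2) ab by simp
qed

lemma commutator_in_jump_bot:
  assumes ab: "a \<in> A" "b \<in> A"
  shows "a \<otimes> b \<otimes> inv (b \<otimes> a) \<in> B"
proof -
  have "a \<otimes> b \<otimes> inv (b \<otimes> a) \<in> A" using ab by auto
  then show ?thesis
  proof (cases rule: Q_cases)
    case 1 then show ?thesis using commutator_aux[OF ab 1] ab by (simp add: m_assoc inv_mult_group)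
  next
    case 2 then show ?thesis using commutator_aux[OF ab(2,1) 2] ab by (simp add: m_assoc inv_mult_group)
  qed
qed

end

section \<open>Changing an ordering on an abelian quotient\<close>

context ccone
begin

text \<open>Since \<open>\<one> < x < x y\<close>, membership of \<open>x y\<close> in
  \<open>C\<close> would put \<open>x\<close> and then \<open>y\<close> into
  \<open>C\<close>.\<close>

lemma outside_mult:
  assumes C: "convex C" and x: "x \<in> P" and y: "y \<in> P" "y \<notin> C"
  shows "x \<otimes> y \<in> P" "x \<otimes> y \<notin> C"
proof -
  note sg = convex_subgroup[OF C]
  show "x \<otimes> y \<in> P" using P_mult x y by blast
  show "x \<otimes> y \<notin> C"
  proof
    assume "x \<otimes> y \<in> C"
    moreover from this have "x \<in> C" using convexD[OF C x, of "x \<otimes> y"] x y by simp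
    ultimately show False using subgroup_mult_iff(2)[OF sg, of x y] y by simp
  qed
qed

text \<open>\<open>S\<close> stands for the pullback of a cone of the abelian group
  \<open>C/D\<close>; signs outside \<open>C\<close> and inside \<open>D\<close> remain those of
  \<open>P\<close>. The commutator hypothesis makes \<open>S\<close> invariant under conjugation by
  \<open>C\<close>, which settles the Conrad condition for pairs inside \<open>C\<close> that meet
  \<open>S\<close>.\<close>

lemma ccone_modify:
  assumes C: "convex C" and D: "convex D" and DC: "D \<subseteq> C"
    and comm: "\<And>x y. \<lbrakk>x \<in> C; y \<in> C\<rbrakk> \<Longrightarrow> x \<otimes> y \<otimes> inv (y \<otimes> x) \<in> D"
    and S: "S \<subseteq> C" "S \<inter> D = {}"
    and S_mult: "\<And>x y. \<lbrakk>x \<in> S; y \<in> S\<rbrakk> \<Longrightarrow> x \<otimes> y \<in> S"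
    and D_mult_S: "\<And>d x. \<lbrakk>d \<in> D; x \<in> S\<rbrakk> \<Longrightarrow> d \<otimes> x \<in> S"
    and S_total: "\<And>x. \<lbrakk>x \<in> C; x \<notin> D\<rbrakk> \<Longrightarrow> x \<in> S \<or> inv x \<in> S"
  shows "ccone G ((P - C) \<union> S \<union> (P \<inter> D))"
proof -
  let ?P = "(P - C) \<union> S \<union> (P \<inter> D)"
  note sC = convex_subgroup[OF C] and sD = convex_subgroup[OF D]
  have Cc: "x \<in> carrier G" if "x \<in> C" for x using subgroup.mem_carrier[OF sC that] .
  have Sc: "x \<in> carrier G" if "x \<in> S" for x using Cc S that by blast
  have Dc: "x \<in> carrier G" if "x \<in> D" for x using Cc DC that by blast
  have conjS: "x \<otimes> (s \<otimes> inv x) \<in> S" if "x \<in> C" "s \<in> S" for x s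
  proof -
    have "(x \<otimes> s \<otimes> inv (s \<otimes> x)) \<otimes> s \<in> S" using that S by (intro D_mult_S comm) auto
    then show ?thesis using that Cc Sc by (simp add: m_assoc inv_mult_group)
  qed
  have conjS': "inv x \<otimes> (s \<otimes> x) \<in> S" if "x \<in> C" "s \<in> S" for x s
    using conjS[OF subgroup.m_inv_closed[OF sC that(1)] that(2)] Cc[OF that(1)] by simp
  have S_mult_D: "s \<otimes> d \<in> S" if "s \<in> S" "d \<in> D" for s d
  proof -
    have "(s \<otimes> d \<otimes> inv (d \<otimes> s)) \<otimes> (d \<otimes> s) \<in> S" using that S DC by (intro D_mult_S comm) auto
    then show ?thesis using that Dc Sc by (simp add: m_assoc inv_mult_group)
  qed
  have PC_C: "x \<otimes> y \<in> P - C" if "x \<in> P - C" "y \<in> C" for x y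
    using that outside_mult_right[OF C, of x y] subgroup_mult_iff[OF sC, of y x] by auto
  have C_PC: "y \<otimes> x \<in> P - C" if "x \<in> P - C" "y \<in> C" for x y
    using that outside_mult_left[OF C, of x y] subgroup_mult_iff[OF sC, of y x] by auto
  have P_PC: "x \<otimes> y \<in> P - C" if "x \<in> P" "y \<in> P - C" for x y
    using that outside_mult[OF C, of x y] by auto
  have P'C: "x \<in> C" if "x \<in> ?P" "x \<notin> P - C" for x using that S DC by auto
  have P'c: "x \<in> carrier G" if "x \<in> ?P" for x using that Sc by auto
  have P'_PC: "x \<otimes> y \<in> P - C" if "x \<in> ?P" "y \<in> P - C" for x y
    using that P_PC[of x y] C_PC[of y x] P'C[of x] by blast
  show ?thesis
  proof
    show "?P \<subseteq> carrier G" using P'c by blast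
    show "\<one> \<notin> ?P"
      using one_notin_P subgroup.one_closed[OF sC] subgroup.one_closed[OF sD] S by auto
  next
    fix x y assume x: "x \<in> ?P" and y: "y \<in> ?P"
    consider "y \<in> P - C" | "x \<in> P - C" "y \<in> C" | "x \<in> S" "y \<in> S" | "x \<in> S" "y \<in> P \<inter> D"
      | "x \<in> P \<inter> D" "y \<in> S" | "x \<in> P \<inter> D" "y \<in> P \<inter> D"
      using x y S DC by blast
    then show "x \<otimes> y \<in> ?P"
    proof cases
      case 1 then show ?thesis using P'_PC x by blast
    next
      case 2 then show ?thesis using PC_C by blast
    next
      case 3 then show ?thesis using S_mult by blast
    next
      case 4 then show ?thesis using S_mult_D by blast
    next
      case 5 then show ?thesis using D_mult_S by blast
    next
      case 6 then show ?thesis using P_mult subgroup.m_closed[OF sD] by blast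
    qed
  next
    fix x assume x: "x \<in> carrier G" "x \<noteq> \<one>"
    show "x \<in> ?P \<or> inv x \<in> ?P"
      using P_total[OF x] S_total[of x] subgroup_inv_iff[OF sC x(1)] subgroup_inv_iff[OF sD x(1)]
      by blast
  next
    fix f g assume f: "f \<in> ?P" and g: "g \<in> ?P"
    have fc: "f \<in> carrier G" and gc: "g \<in> carrier G" using f g P'c by auto
    consider "g \<in> P - C" | "g \<in> C" "f \<in> P - C" | "g \<in> C" "f \<in> S"
      | "f \<in> P \<inter> D" "g \<in> S" | "f \<in> P \<inter> D" "g \<in> P \<inter> D"
      using f g S DC by blast
    then show "\<exists>n\<ge>1::nat. inv g \<otimes> (f \<otimes> g [^] n) \<in> ?P"
    proof cases
      case 1
      \<comment> \<open>\<open>f\<close> may be negative for \<open>P\<close>, so the Conrad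
        property of \<open>P\<close> is applied to \<open>f g\<close> instead. Its result is only
        known to be in \<open>P\<close>; one more factor \<open>g\<close> moves it out of
        \<open>C\<close>.\<close>
      have "f \<otimes> g \<in> P - C" using P'_PC f 1 by blast
      then obtain n where n: "n \<ge> 1" "inv g \<otimes> ((f \<otimes> g) \<otimes> g [^] (n::nat)) \<in> P"
        using P_conrad[of "f \<otimes> g" g] 1 by auto
      have "(inv g \<otimes> ((f \<otimes> g) \<otimes> g [^] n)) \<otimes> g \<in> P - C" using P_PC[OF n(2) 1] .
      also have "(inv g \<otimes> ((f \<otimes> g) \<otimes> g [^] n)) \<otimes> g = inv g \<otimes> (f \<otimes> g [^] Suc (Suc n))"
        using fc gc nat_pow_Suc2[of g n] by (simp add: m_assoc)
      finally show ?thesis by (intro exI[of _ "Suc (Suc n)"]) auto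
    next
      case 2
      have "inv g \<otimes> (f \<otimes> g) \<in> P - C"
        using C_PC[OF PC_C[OF 2(2,1)] subgroup.m_inv_closed[OF sC 2(1)]] .
      then show ?thesis using gc by (intro exI[of _ 1]) auto
    next
      case 3
      then show ?thesis using gc conjS'[of g f] by (intro exI[of _ 1]) auto
    next
      case 4
      \<comment> \<open>Exponent one would give a conjugate of \<open>f\<close>, an element of
        \<open>D\<close> whose sign is not controlled; exponent two leaves a factor from
        \<open>S\<close>.\<close>
      then have "f \<otimes> g \<in> S" using D_mult_S by blast
      then have "inv g \<otimes> ((f \<otimes> g) \<otimes> g) \<in> S" using conjS' 4 S by blast
      then show ?thesis using fc gc by (intro exI[of _ 2]) (auto simp: numeral_2_eq_2 m_assoc)
    next
      case 5
      then obtain n where n: "n \<ge> 1" "inv g \<otimes> (f \<otimes> g [^] (n::nat)) \<in> P"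
        using P_conrad[of f g] by auto
      have "g [^] n \<in> D" using convex_pow_iff[OF D gc n(1)] 5 by blast
      then have "inv g \<otimes> (f \<otimes> g [^] n) \<in> D"
        using 5 subgroup.m_closed[OF sD] subgroup.m_inv_closed[OF sD] by blast
      then show ?thesis using n by blast
    qed
  qed
qed

end

section \<open>Orderings of torsion-free abelian groups\<close>

context comm_group
begin

text \<open>Cones in this part are weak, that is, they contain \<open>\<one>\<close> in contrast to
  \<open>P\<close>, so that generating and adjoining are operations on submonoids.\<close>

definition submon :: "'a set \<Rightarrow> bool" where
  "submon M \<longleftrightarrow> M \<subseteq> carrier G \<and> \<one> \<in> M \<and> (\<forall>x\<in>M. \<forall>y\<in>M. x \<otimes> y \<in> M)"

definition pointed :: "'a set \<Rightarrow> bool" where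
  "pointed M \<longleftrightarrow> submon M \<and> (\<forall>x\<in>M. inv x \<in> M \<longrightarrow> x = \<one>)"

definition total_cone :: "'a set \<Rightarrow> bool" where
  "total_cone N \<longleftrightarrow> pointed N \<and> (\<forall>x\<in>carrier G. x \<in> N \<or> inv x \<in> N)"

definition adj :: "'a set \<Rightarrow> 'a \<Rightarrow> 'a set" where
  "adj M x = {m \<otimes> x [^] n |m n. m \<in> M \<and> n \<in> (UNIV::nat set)}"

definition gen :: "'a set \<Rightarrow> 'a set" where
  "gen X = \<Inter>{M. submon M \<and> X \<subseteq> M}"

lemma submonD:
  assumes "submon M"
  shows "x \<in> M \<Longrightarrow> x \<in> carrier G" "\<one> \<in> M" "\<lbrakk>x \<in> M; y \<in> M\<rbrakk> \<Longrightarrow> x \<otimes> y \<in> M"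
  using assms by (auto simp: submon_def)

lemma submon_pow: "\<lbrakk>submon M; x \<in> M\<rbrakk> \<Longrightarrow> x [^] (n::nat) \<in> M"
  by (induction n) (simp_all add: submonD)

lemma adjI: "m \<in> M \<Longrightarrow> m \<otimes> x [^] (n::nat) \<in> adj M x"
  by (auto simp: adj_def)

lemma adjE:
  assumes "y \<in> adj M x"
  obtains m n where "m \<in> M" "y = m \<otimes> x [^] (n::nat)"
  using assms by (auto simp: adj_def)

lemma adj_mult_eq:
  assumes "m \<in> carrier G" "m' \<in> carrier G" "x \<in> carrier G"
  shows "(m \<otimes> x [^] (k::nat)) \<otimes> (m' \<otimes> x [^] (l::nat)) = (m \<otimes> m') \<otimes> x [^] (k + l)"
  using assms by (simp add: nat_pow_mult[symmetric] m_ac)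

lemma subset_adj: "M \<subseteq> carrier G \<Longrightarrow> M \<subseteq> adj M x"
proof
  fix m assume "M \<subseteq> carrier G" "m \<in> M"
  then show "m \<in> adj M x" using adjI[of m M x 0] by auto
qed

lemma submon_adj:
  assumes M: "submon M" and x: "x \<in> carrier G"
  shows "submon (adj M x)"
  unfolding submon_def
proof (intro conjI ballI)
  show "adj M x \<subseteq> carrier G" using submonD(1)[OF M] x by (auto elim!: adjE)
  show "\<one> \<in> adj M x" using adjI[OF submonD(2)[OF M], of x 0] by simp
  fix y z assume "y \<in> adj M x" "z \<in> adj M x"
  then show "y \<otimes> z \<in> adj M x"
    using submonD[OF M] x by (auto elim!: adjE simp: adj_mult_eq intro!: adjI)
qed

lemma self_in_adj: "\<lbrakk>submon M; x \<in> carrier G\<rbrakk> \<Longrightarrow> x \<in> adj M x"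
  using adjI[of \<one> M x 1] submonD(2)[of M] by simp

lemma gen_least: "\<lbrakk>submon M; X \<subseteq> M\<rbrakk> \<Longrightarrow> gen X \<subseteq> M"
  by (auto simp: gen_def)

lemma gen_subset: "X \<subseteq> gen X"
  by (auto simp: gen_def)

lemma submon_gen:
  assumes "X \<subseteq> carrier G" shows "submon (gen X)"
proof -
  have "submon (carrier G)" by (simp add: submon_def)
  then have "gen X \<subseteq> carrier G" using gen_least assms by blast
  then show ?thesis unfolding submon_def by (auto simp: gen_def submonD)
qed

lemma gen_insert:
  assumes "X \<subseteq> carrier G" "x \<in> carrier G"
  shows "gen (insert x X) \<subseteq> adj (gen X) x"
proof (rule gen_least)
  note s = submon_gen[OF assms(1)]
  show "submon (adj (gen X) x)" using submon_adj s assms by blast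
  show "insert x X \<subseteq> adj (gen X) x"
    using self_in_adj[OF s assms(2)] subset_adj[of "gen X" x] gen_subset[of X] submonD(1)[OF s]
    by blast
qed

text \<open>If \<open>m x^k\<close> and \<open>m' x^l\<close> are mutually inverse, then
  \<open>(inv x)^(k+l) = m m'\<close> lies in \<open>M\<close>, which is possible only for
  \<open>k = l = 0\<close>.\<close>

lemma pointed_adj:
  assumes M: "pointed M" and x: "x \<in> carrier G" and n: "\<And>n::nat. n \<ge> 1 \<Longrightarrow> inv x [^] n \<notin> M"
  shows "pointed (adj M x)"
proof -
  have s: "submon M" using M by (simp add: pointed_def)
  have "y = \<one>" if y: "y \<in> adj M x" "inv y \<in> adj M x" for y
  proof -
    obtain m k where mk: "m \<in> M" "y = m \<otimes> x [^] (k::nat)" using y(1) by (rule adjE)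
    obtain m' l where ml: "m' \<in> M" "inv y = m' \<otimes> x [^] (l::nat)" using y(2) by (rule adjE)
    have c: "m \<in> carrier G" "m' \<in> carrier G" using mk ml submonD(1)[OF s] by auto
    have "y \<otimes> inv y = \<one>" using mk c x by simp
    then have eq: "(m \<otimes> m') \<otimes> x [^] (k + l) = \<one>"
      unfolding mk(2) using ml(2) mk(2) adj_mult_eq[OF c x] by metis
    then have "inv (x [^] (k + l)) = m \<otimes> m'"
      using c x by (simp add: inv_equality)
    then have "inv x [^] (k + l) \<in> M"
      using x mk ml submonD(3)[OF s] by (simp add: nat_pow_inv)
    then have "\<not> k + l \<ge> 1" using n by blast
    then have kl: "k = 0" "l = 0" by auto
    then have "inv m = m'" using eq c by (simp add: inv_equality m_comm)
    then have "m = \<one>" using M mk ml by (auto simp: pointed_def)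
    then show ?thesis using mk kl by simp
  qed
  then show ?thesis using submon_adj[OF s x] by (simp add: pointed_def)
qed

text \<open>If a maximal pointed \<open>N\<close> misses both \<open>x\<close> and its inverse,
  neither can be adjoined, so \<open>x^l\<close> and \<open>(inv x)^k\<close> lie in
  \<open>N\<close> for some \<open>k, l \<ge> 1\<close>. Then \<open>x^(k l)\<close> and its inverse
  lie in \<open>N\<close>, and torsion-freeness gives \<open>x = \<one>\<close>.\<close>

lemma pointed_extend:
  assumes tf: "\<forall>x\<in>carrier G. \<forall>n\<ge>1::nat. x [^] n = \<one> \<longrightarrow> x = \<one>"
    and M: "pointed M"
  shows "\<exists>N. total_cone N \<and> M \<subseteq> N"
proof -
  define \<A> where "\<A> = {N. pointed N \<and> M \<subseteq> N}"
  have "\<exists>N\<in>\<A>. \<forall>X\<in>\<A>. N \<subseteq> X \<longrightarrow> X = N"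
  proof (rule subset_Zorn_nonempty)
    show "\<A> \<noteq> {}" using M by (auto simp: \<A>_def)
    fix \<C> assume ne: "\<C> \<noteq> {}" and ch: "subset.chain \<A> \<C>"
    have sub: "\<And>N. N \<in> \<C> \<Longrightarrow> pointed N \<and> M \<subseteq> N" using ch by (auto simp: subset_chain_def \<A>_def)
    have subm: "\<And>N. N \<in> \<C> \<Longrightarrow> submon N" using sub by (simp add: pointed_def)
    have common: "\<exists>N\<in>\<C>. x \<in> N \<and> y \<in> N" if xy: "x \<in> \<Union>\<C>" "y \<in> \<Union>\<C>" for x y
    proof -
      obtain K L where KL: "K \<in> \<C>" "x \<in> K" "L \<in> \<C>" "y \<in> L" using xy by blast
      then have "K \<subseteq> L \<or> L \<subseteq> K" using ch by (simp add: subset_chain_def)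
      then show ?thesis using KL by blast
    qed
    have "submon (\<Union>\<C>)" unfolding submon_def
    proof (intro conjI ballI)
      show "\<Union>\<C> \<subseteq> carrier G" using subm submonD(1) by blast
      show "\<one> \<in> \<Union>\<C>" using subm submonD(2) ne by blast
      fix x y assume "x \<in> \<Union>\<C>" "y \<in> \<Union>\<C>"
      then obtain N where "N \<in> \<C>" "x \<in> N" "y \<in> N" using common by blast
      then show "x \<otimes> y \<in> \<Union>\<C>" using submonD(3)[OF subm] by blast
    qed
    moreover have "x = \<one>" if xy: "x \<in> \<Union>\<C>" "inv x \<in> \<Union>\<C>" for x
    proof -
      obtain N where "N \<in> \<C>" "x \<in> N" "inv x \<in> N" using common[OF xy] by blast
      then show ?thesis using sub[of N] by (auto simp: pointed_def)
    qed
    ultimately have "pointed (\<Union>\<C>)" by (simp add: pointed_def)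
    moreover have "M \<subseteq> \<Union>\<C>" using sub ne by blast
    ultimately show "\<Union>\<C> \<in> \<A>" by (simp add: \<A>_def)
  qed
  then obtain N where N: "pointed N" "M \<subseteq> N" and max: "\<And>X. \<lbrakk>pointed X; N \<subseteq> X\<rbrakk> \<Longrightarrow> X = N"
    by (auto simp: \<A>_def)
  have s: "submon N" using N by (simp add: pointed_def)
  have ex: "\<exists>n\<ge>1::nat. inv x [^] n \<in> N" if x: "x \<in> carrier G" "x \<notin> N" for x
  proof (rule ccontr)
    assume "\<not> ?thesis"
    then have "pointed (adj N x)" using pointed_adj[OF N(1) x(1)] by blast
    moreover have "N \<subseteq> adj N x" using subset_adj s by (simp add: submon_def)
    ultimately have "adj N x = N" using max by blast
    then show False using self_in_adj[OF s x(1)] x(2) by simp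
  qed
  have "x \<in> N \<or> inv x \<in> N" if x: "x \<in> carrier G" for x
  proof (rule ccontr)
    assume n: "\<not> ?thesis"
    obtain k where k: "k \<ge> 1" "inv x [^] (k::nat) \<in> N" using ex[OF x] n by blast
    obtain l where l: "l \<ge> 1" "x [^] (l::nat) \<in> N" using ex[of "inv x"] x n by auto
    have "(inv x [^] k) [^] l \<in> N" "(x [^] l) [^] k \<in> N" using submon_pow[OF s] k l by auto
    then have "inv (x [^] (k * l)) \<in> N" "x [^] (k * l) \<in> N"
      using x by (simp_all add: nat_pow_pow nat_pow_inv mult.commute)
    then have "x [^] (k * l) = \<one>" using N(1) by (simp add: pointed_def)
    moreover have "k * l \<ge> 1" using k l by simp
    ultimately have "x = \<one>" using tf x by blast
    then show False using n submonD(2)[OF s] by simp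
  qed
  then have "total_cone N" using N by (simp add: total_cone_def)
  then show ?thesis using N by blast
qed

text \<open>Otherwise \<open>inv q\<close> could be adjoined to \<open>gen X\<close>, and a total
  cone extending the result would contradict uniqueness. Isolation thus turns into finite generation
  up to roots.\<close>

lemma unique_cone_power_in_gen:
  assumes tf: "\<forall>x\<in>carrier G. \<forall>n\<ge>1::nat. x [^] n = \<one> \<longrightarrow> x = \<one>"
    and N: "total_cone N" and X: "X \<subseteq> N"
    and uniq: "\<forall>N'. total_cone N' \<and> X \<subseteq> N' \<longrightarrow> N' = N"
    and q: "q \<in> N"
  shows "\<exists>k\<ge>1::nat. q [^] k \<in> gen X"
proof (rule ccontr)
  assume n: "\<not> ?thesis"
  have pN: "pointed N" and sN: "submon N" using N by (auto simp: total_cone_def pointed_def)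
  have qc: "q \<in> carrier G" using submonD(1)[OF sN q] .
  have Xc: "X \<subseteq> carrier G" using X submonD(1)[OF sN] by blast
  note s = submon_gen[OF Xc]
  have "gen X \<subseteq> N" using gen_least[OF sN X] .
  then have pg: "pointed (gen X)" using pN s by (auto simp: pointed_def)
  have "pointed (adj (gen X) (inv q))"
    by (rule pointed_adj[OF pg]) (use n qc in auto)
  then obtain N' where N': "total_cone N'" "adj (gen X) (inv q) \<subseteq> N'"
    using pointed_extend[OF tf] by blast
  have "X \<subseteq> N'"
    using N'(2) subset_adj[of "gen X" "inv q"] gen_subset[of X] submonD(1)[OF s] by blast
  then have "N' = N" using uniq N' by blast
  then have "inv q \<in> N" using N'(2) self_in_adj[OF s, of "inv q"] qc by auto
  then have "q = \<one>" using pN q by (simp add: pointed_def)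
  then have "q [^] (1::nat) \<in> gen X" using submonD(2)[OF s] by simp
  then show False using n by blast
qed

text \<open>Of two elements \<open>a\<close>, \<open>b\<close> of a minimal generating set, say with \<open>b < a\<close>, the element
  \<open>a\<close> is redundant: express a power of \<open>a b\<^sup>-\<^sup>1\<close> by generators and solve for \<open>a\<close>.\<close>

lemma unique_cone_cyclic:
  assumes tf: "\<forall>x\<in>carrier G. \<forall>n\<ge>1::nat. x [^] n = \<one> \<longrightarrow> x = \<one>"
    and N: "total_cone N" and X: "X \<subseteq> N" "finite X"
    and uniq: "\<forall>N'. total_cone N' \<and> X \<subseteq> N' \<longrightarrow> N' = N"
  shows "\<exists>f\<in>N. \<forall>q\<in>N. \<exists>k\<ge>1::nat. \<exists>n::nat. q [^] k = f [^] n"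
proof -
  have pN: "pointed N" and sN: "submon N" using N by (auto simp: total_cone_def pointed_def)
  have Nc: "x \<in> carrier G" if "x \<in> N" for x using submonD(1)[OF sN that] .
  define spans where "spans Y \<longleftrightarrow> Y \<subseteq> N \<and> finite Y \<and> (\<forall>q\<in>N. \<exists>k\<ge>1::nat. q [^] k \<in> gen Y)" for Y
  have "spans X" using unique_cone_power_in_gen[OF tf N X(1) uniq] X by (simp add: spans_def)
  then obtain Y where Y: "spans Y" and Ymin: "\<And>Z. spans Z \<Longrightarrow> card Y \<le> card Z"
    using ex_has_least_nat[of spans X card] by blast
  have YN: "Y \<subseteq> N" and Yfin: "finite Y" using Y by (auto simp: spans_def)
  \<comment> \<open>Generation is counted up to powers, so minimality of \<open>card Y\<close>
    forbids even a power of \<open>a\<close> to be generated by the rest.\<close>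
  have irredundant: "a [^] k \<notin> gen (Y - {a})" if a: "a \<in> Y" and k: "k \<ge> 1" for a and k :: nat
  proof
    assume ak: "a [^] k \<in> gen (Y - {a})"
    have ac: "a \<in> carrier G" using a YN Nc by blast
    have Zc: "Y - {a} \<subseteq> carrier G" using YN Nc by blast
    note s = submon_gen[OF Zc]
    have "\<exists>j\<ge>1::nat. q [^] j \<in> gen (Y - {a})" if q: "q \<in> N" for q
    proof -
      obtain j where j: "j \<ge> 1" "q [^] (j::nat) \<in> gen Y" using Y q by (auto simp: spans_def)
      have "insert a (Y - {a}) = Y" using a by blast
      then have "q [^] j \<in> adj (gen (Y - {a})) a" using gen_insert[OF Zc ac] j by auto
      then obtain m n where m: "m \<in> gen (Y - {a})" "q [^] j = m \<otimes> a [^] (n::nat)" by (rule adjE)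
      have mc: "m \<in> carrier G" using submonD(1)[OF s m(1)] .
      have "q [^] (j * k) = (q [^] j) [^] k" using Nc[OF q] by (simp add: nat_pow_pow)
      also have "\<dots> = m [^] k \<otimes> (a [^] k) [^] n"
        using m mc ac by (simp add: nat_pow_distrib nat_pow_pow mult.commute)
      also have "\<dots> \<in> gen (Y - {a})" using submon_pow[OF s] submonD(3)[OF s] m ak by simp
      finally show ?thesis using j k by (intro exI[of _ "j * k"]) simp
    qed
    then have "spans (Y - {a})" using YN Yfin by (auto simp: spans_def)
    then have "card Y \<le> card (Y - {a})" by (rule Ymin)
    then show False using card_Diff1_less[OF Yfin a] by simp
  qed
  have two: False if ab: "a \<in> Y" "b \<in> Y" "a \<noteq> b" "a \<otimes> inv b \<in> N" for a b
  proof -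
    have c: "a \<in> carrier G" "b \<in> carrier G" using ab YN Nc by auto
    have ab_N: "a \<in> N" "b \<in> N" using ab YN by auto
    define Z where "Z = Y - {a} - {b}"
    have Zc: "Z \<subseteq> carrier G" and Ya: "Y - {a} = insert b Z" and YZ: "Y = insert a (insert b Z)"
      and Yac: "Y - {a} \<subseteq> carrier G" and bZc: "insert b Z \<subseteq> carrier G"
      using YN Nc ab unfolding Z_def by auto
    obtain k where k: "k \<ge> 1" "(a \<otimes> inv b) [^] (k::nat) \<in> gen Y" using Y ab by (auto simp: spans_def)
    then have "(a \<otimes> inv b) [^] k \<in> adj (gen (insert b Z)) a" using gen_insert[OF bZc c(1)] YZ by auto
    then obtain m1 n where m1: "m1 \<in> gen (insert b Z)" "(a \<otimes> inv b) [^] k = m1 \<otimes> a [^] (n::nat)"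
      by (rule adjE)
    have "m1 \<in> adj (gen Z) b" using gen_insert[OF Zc c(2)] m1 by blast
    then obtain m l where m: "m \<in> gen Z" "m1 = m \<otimes> b [^] (l::nat)" by (rule adjE)
    have gZ: "gen Z \<subseteq> gen (Y - {a})"
      using gen_least[OF submon_gen[OF Yac], of Z] gen_subset[of "Y - {a}"] Ya by blast
    have gN: "gen Z \<subseteq> N" using gen_least[OF sN, of Z] YN by (auto simp: Z_def)
    have mc: "m \<in> carrier G" using gN m Nc by blast
    have "a [^] k = (a \<otimes> inv b) [^] k \<otimes> b [^] k"
      using c by (simp add: nat_pow_distrib[symmetric] m_assoc)
    also have "\<dots> = (m \<otimes> b [^] (l + k)) \<otimes> a [^] n"
      unfolding m1(2) m(2) using c mc by (simp add: nat_pow_mult[symmetric] m_ac)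
    finally have eq: "a [^] k = (m \<otimes> b [^] (l + k)) \<otimes> a [^] n" .
    \<comment> \<open>A surplus of \<open>a\<close> on the left makes a power of \<open>a\<close>
      redundant. Otherwise the inverse of a power of \<open>b\<close> is seen to lie in
      \<open>N\<close>, so \<open>b = \<one>\<close>, which is redundant as well.\<close>
    show False
    proof (cases "k > n")
      case True
      have "a [^] (k - n) \<otimes> a [^] n = a [^] k" using True c by (simp add: nat_pow_mult)
      then have "a [^] (k - n) = m \<otimes> b [^] (l + k)" using eq c mc by (metis m_closed nat_pow_closed right_cancel)
      moreover have "b \<in> gen (Y - {a})" using gen_subset[of "Y - {a}"] Ya by blast
      then have "m \<otimes> b [^] (l + k) \<in> gen (Y - {a})"
        using submonD(3)[OF submon_gen[OF Yac]] submon_pow[OF submon_gen[OF Yac]] m gZ by blast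
      ultimately have "a [^] (k - n) \<in> gen (Y - {a})" by simp
      then show False using irredundant[OF ab(1), of "k - n"] True by simp
    next
      case False
      have "a [^] (n - k) \<otimes> a [^] k = a [^] n" using False c by (simp add: nat_pow_mult)
      then have "\<one> \<otimes> a [^] k = ((m \<otimes> b [^] (l + k)) \<otimes> a [^] (n - k)) \<otimes> a [^] k"
        using eq c mc by (simp add: m_assoc)
      then have "\<one> = (m \<otimes> b [^] (l + k)) \<otimes> a [^] (n - k)"
        using c mc by (metis m_closed nat_pow_closed right_cancel one_closed)
      then have "(m \<otimes> a [^] (n - k)) \<otimes> b [^] (l + k) = \<one>" using c mc by (simp add: m_ac)
      then have "inv (b [^] (l + k)) = m \<otimes> a [^] (n - k)" using c mc by (simp add: inv_equality)
      moreover have "m \<otimes> a [^] (n - k) \<in> N"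
        using submonD(3)[OF sN] submon_pow[OF sN] gN m ab_N by blast
      ultimately have "b [^] (l + k) = \<one>"
        using pN submon_pow[OF sN ab_N(2), of "l + k"] by (simp add: pointed_def)
      moreover have "l + k \<ge> 1" using k by simp
      ultimately have "b = \<one>" using tf c(2) by blast
      then have "b [^] (1::nat) \<in> gen (Y - {b})"
        using submonD(2)[OF submon_gen, of "Y - {b}"] YN Nc by auto
      then show False using irredundant[OF ab(2), of 1] by simp
    qed
  qed
  have one: "a = b" if ab: "a \<in> Y" "b \<in> Y" for a b
  proof (rule ccontr)
    assume ne: "a \<noteq> b"
    have c: "a \<in> carrier G" "b \<in> carrier G" using ab YN Nc by auto
    have "a \<otimes> inv b \<in> N \<or> inv (a \<otimes> inv b) \<in> N" using N c by (simp add: total_cone_def)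
    moreover have "inv (a \<otimes> inv b) = b \<otimes> inv a" using c by (simp add: inv_mult_group)
    ultimately show False using two[OF ab ne] two[OF ab(2,1)] ne by auto
  qed
  obtain f where f: "f \<in> N" "Y \<subseteq> {f}" using one submonD(2)[OF sN] YN by blast
  have "submon {\<one>}" by (simp add: submon_def)
  then have "submon (adj {\<one>} f)" "f \<in> adj {\<one>} f" using submon_adj self_in_adj Nc f by auto
  then have "gen Y \<subseteq> adj {\<one>} f" using gen_least f by blast
  then have g: "\<exists>n::nat. x = f [^] n" if "x \<in> gen Y" for x
    using that Nc[OF f(1)] by (auto simp: adj_def)
  show ?thesis
  proof (intro bexI[of _ f] ballI)
    fix q assume "q \<in> N"
    then obtain k where "k \<ge> 1" "q [^] (k::nat) \<in> gen Y" using Y by (auto simp: spans_def)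
    then show "\<exists>k\<ge>1::nat. \<exists>n::nat. q [^] k = f [^] n" using g by blast
  qed (rule f)
qed

lemma unique_cone_rank_one:
  assumes tf: "\<forall>x\<in>carrier G. \<forall>n\<ge>1::nat. x [^] n = \<one> \<longrightarrow> x = \<one>"
    and N: "total_cone N" and X: "X \<subseteq> N" "finite X"
    and uniq: "\<forall>N'. total_cone N' \<and> X \<subseteq> N' \<longrightarrow> N' = N"
    and c: "c \<in> carrier G" "c \<noteq> \<one>" and y: "y \<in> carrier G"
  shows "\<exists>k\<ge>1::nat. \<exists>m::int. y [^] k = c [^] m"
proof -
  have sN: "submon N" using N by (auto simp: total_cone_def pointed_def)
  obtain f where f: "f \<in> N" and fN: "\<And>q. q \<in> N \<Longrightarrow> \<exists>k\<ge>1::nat. \<exists>n::nat. q [^] k = f [^] n"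
    using unique_cone_cyclic[OF tf N X uniq] by blast
  have fc: "f \<in> carrier G" using submonD(1)[OF sN f] .
  have ex: "\<exists>k\<ge>1::nat. \<exists>n::int. q [^] (int k) = f [^] n" if q: "q \<in> carrier G" for q
  proof (cases "q \<in> N")
    case True
    then show ?thesis using fN by (metis int_pow_int)
  next
    case False
    then have "inv q \<in> N" using N q by (auto simp: total_cone_def)
    then obtain k n where kn: "k \<ge> 1" "inv q [^] (k::nat) = f [^] (n::nat)" using fN by blast
    have "q [^] k = inv (inv q [^] k)" using q by (simp add: nat_pow_inv)
    also have "\<dots> = f [^] (- int n)" using kn fc by (simp add: int_pow_neg_int)
    finally show ?thesis using kn by (metis int_pow_int)
  qed
  obtain k n where kn: "k \<ge> 1" "y [^] (int k) = f [^] (n::int)" using ex[OF y] by blast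
  obtain l m where lm: "l \<ge> 1" "c [^] (int l) = f [^] (m::int)" using ex[OF c(1)] by blast
  have m0: "m \<noteq> 0"
  proof
    assume "m = 0"
    then have "c [^] l = \<one>" using lm by (simp add: int_pow_int)
    then show False using tf c lm(1) by blast
  qed
  \<comment> \<open>Powers of \<open>y\<close> and \<open>c\<close> are brought to the common value
    \<open>f^(n |m|)\<close>. The absolute value keeps the exponent of \<open>y\<close> natural; the
    sign of \<open>m\<close> passes to the exponent of \<open>c\<close>.\<close>
  have "y [^] (k * nat \<bar>m\<bar>) = y [^] (int k * \<bar>m\<bar>)"
    using int_pow_int[of G y "k * nat \<bar>m\<bar>"] by simp
  also have "\<dots> = f [^] (n * \<bar>m\<bar>)" using kn y fc by (simp add: int_pow_pow[symmetric])
  also have "n * \<bar>m\<bar> = m * (n * sgn m)" by (simp add: abs_sgn mult.commute mult.left_commute)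
  also have "f [^] (m * (n * sgn m)) = c [^] (int l * (n * sgn m))"
    using lm c fc by (simp add: int_pow_pow[symmetric])
  finally show ?thesis using m0 kn by (intro exI[of _ "k * nat \<bar>m\<bar>"]) auto
qed

end

section \<open>Isolated orderings\<close>

context ccone
begin

lemma finite_jump_top_bound:
  assumes "finite T" "T \<noteq> {}" "T \<subseteq> carrier G"
  shows "\<exists>s\<in>T. T \<subseteq> jump_top s"
proof -
  have "\<exists>M\<in>jump_top ` T. \<forall>H\<in>jump_top ` T. M \<subseteq> H \<longrightarrow> M = H"
    using finite_has_maximal[of "jump_top ` T"] assms(1,2) by simp
  then obtain M where M: "M \<in> jump_top ` T" "\<And>H. H \<in> jump_top ` T \<Longrightarrow> M \<subseteq> H \<Longrightarrow> M = H"
    by blast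
  then obtain s where s: "s \<in> T" "M = jump_top s" by blast
  have "t \<in> jump_top s" if t: "t \<in> T" for t
  proof -
    have "jump_top t \<subseteq> jump_top s \<or> jump_top s \<subseteq> jump_top t"
      using convex_chain[OF convex_jump_top convex_jump_top, of t s] assms(3) s(1) t by blast
    then have "jump_top t \<subseteq> jump_top s" using M(2)[of "jump_top t"] s t by blast
    then show ?thesis using self_in_jump_top[of t] by blast
  qed
  then show ?thesis using s by blast
qed

lemma jump_top_one: "jump_top \<one> = {\<one>}"
  using jump_top_least[OF convex_one, of \<one>] self_in_jump_top[of \<one>] by blast

lemma pow_in_P_iff:
  assumes "x \<in> carrier G" "k \<ge> (1::nat)"
  shows "x [^] k \<in> P \<longleftrightarrow> x \<in> P"
proof
  assume k: "x [^] k \<in> P"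
  show "x \<in> P"
  proof (rule ccontr)
    assume n: "x \<notin> P"
    have "x \<noteq> \<one>" using k one_notin_P by auto
    then have "inv x \<in> P" using P_total[OF assms(1)] n by blast
    then have "inv x [^] k \<in> P" using P_pow assms by blast
    then show False using inv_notin_P[OF k] assms by (simp add: nat_pow_inv)
  qed
qed (use assms P_pow in blast)

text \<open>Moves \<open>C/D\<close> into the setting of abelian groups. Normality of
  \<open>D\<close> in \<open>C\<close> follows from the commutator hypothesis, since
  \<open>x h x^-1\<close> is a commutator times \<open>h\<close>.\<close>

lemma quotient_hom:
  assumes C: "subgroup C G" and D: "subgroup D G" and DC: "D \<subseteq> C"
    and comm: "\<And>x y. \<lbrakk>x \<in> C; y \<in> C\<rbrakk> \<Longrightarrow> x \<otimes> y \<otimes> inv (y \<otimes> x) \<in> D"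
  obtains V :: "'a set monoid" and p where "comm_group V" "group_hom (G\<lparr>carrier := C\<rparr>) V p"
    "p ` C = carrier V" "\<And>x. x \<in> C \<Longrightarrow> p x = \<one>\<^bsub>V\<^esub> \<longleftrightarrow> x \<in> D"
proof -
  let ?H = "G\<lparr>carrier := C\<rparr>"
  interpret H: group ?H using subgroup.subgroup_is_group[OF C] group_axioms by blast
  have Cc: "x \<in> carrier G" if "x \<in> C" for x using subgroup.mem_carrier[OF C that] .
  have invH: "inv\<^bsub>?H\<^esub> x = inv x" if "x \<in> C" for x using m_inv_consistent[OF C that] .
  have DH: "subgroup D ?H" using subgroup_incl[OF D C DC] .
  have "D \<lhd> ?H" unfolding H.normal_inv_iff
  proof (intro conjI ballI DH)
    fix x h assume x: "x \<in> carrier ?H" and h: "h \<in> D"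
    have hC: "h \<in> C" using h DC by blast
    have "(x \<otimes> h \<otimes> inv (h \<otimes> x)) \<otimes> h \<in> D"
      using comm[of x h] x h hC subgroup.m_closed[OF D] by simp
    moreover have "(x \<otimes> h \<otimes> inv (h \<otimes> x)) \<otimes> h = x \<otimes> h \<otimes> inv x"
      using x hC Cc by (simp add: m_assoc inv_mult_group)
    ultimately show "x \<otimes>\<^bsub>?H\<^esub> h \<otimes>\<^bsub>?H\<^esub> inv\<^bsub>?H\<^esub> x \<in> D" using x invH by simp
  qed
  then interpret N: normal D ?H .
  let ?V = "?H Mod D"
  define p where "p = (\<lambda>x. D #>\<^bsub>?H\<^esub> x)"
  interpret V: group ?V by (rule N.factorgroup_is_group)
  have hom: "p \<in> hom ?H ?V" unfolding p_def by (rule N.r_coset_hom_Mod)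
  have gh: "group_hom ?H ?V p"
    by (intro group_hom.intro group_hom_axioms.intro hom H.group_axioms V.group_axioms)
  have surj: "p ` C = carrier ?V" by (simp add: carrier_FactGroup p_def)
  have ker: "p x = \<one>\<^bsub>?V\<^esub> \<longleftrightarrow> x \<in> D" if "x \<in> C" for x
    using H.coset_join1[of D x] H.coset_join2[of x D] that DH N.subset by (auto simp: p_def)
  have pm: "p (x \<otimes> y) = p x \<otimes>\<^bsub>?V\<^esub> p y" if "x \<in> C" "y \<in> C" for x y
    using hom_mult[OF hom, of x y] that by simp
  have "comm_group ?V"
  proof (rule V.group_comm_groupI)
    fix u v assume uv: "u \<in> carrier ?V" "v \<in> carrier ?V"
    have "u \<in> p ` C" "v \<in> p ` C" using uv surj by simp_all
    then obtain x y where xy: "x \<in> C" "u = p x" "y \<in> C" "v = p y" by (elim imageE) simp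
    have c: "x \<otimes> y \<in> C" "y \<otimes> x \<in> C" using xy subgroup.m_closed[OF C] by auto
    have k: "x \<otimes> y \<otimes> inv (y \<otimes> x) \<in> D" using comm xy by blast
    have "x \<otimes> y = (x \<otimes> y \<otimes> inv (y \<otimes> x)) \<otimes> (y \<otimes> x)"
      using xy Cc by (simp add: m_assoc inv_mult_group)
    then have "p (x \<otimes> y) = p (x \<otimes> y \<otimes> inv (y \<otimes> x)) \<otimes>\<^bsub>?V\<^esub> p (y \<otimes> x)"
      using pm[of "x \<otimes> y \<otimes> inv (y \<otimes> x)" "y \<otimes> x"] k DC c by auto
    also have "p (x \<otimes> y \<otimes> inv (y \<otimes> x)) = \<one>\<^bsub>?V\<^esub>" using ker k DC by blast
    also have "\<one>\<^bsub>?V\<^esub> \<otimes>\<^bsub>?V\<^esub> p (y \<otimes> x) = p (y \<otimes> x)"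
      by (rule V.l_one) (use surj c in blast)
    finally show "u \<otimes>\<^bsub>?V\<^esub> v = v \<otimes>\<^bsub>?V\<^esub> u" using pm xy by simp
  qed
  then show thesis using that gh surj ker by blast
qed

end

section \<open>Jumps of an isolated cone\<close>

locale isolated_ccone = ccone +
  fixes F
  assumes F_finite: "finite F" and F_carrier: "F \<subseteq> carrier G"
    and isolated: "\<And>P'. \<lbrakk>ccone G P'; P' \<inter> F = P \<inter> F\<rbrakk> \<Longrightarrow> P' = P"
begin

text \<open>Otherwise the ordering could be reversed on the jump of \<open>g\<close>.\<close>

lemma jump_meets_F:
  assumes g: "g \<in> carrier G" "g \<noteq> \<one>"
  shows "\<exists>f\<in>F. f \<in> jump_top g \<and> f \<notin> jump_bot g"
proof (rule ccontr)
  assume n: "\<not> ?thesis"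
  interpret J: cjump G P g by unfold_locales (use g in auto)
  define S where "S = {x \<in> jump_top g. inv x \<in> J.Q}"
  have "ccone G ((P - jump_top g) \<union> S \<union> (P \<inter> jump_bot g))"
  proof (rule ccone_modify[OF J.A_convex J.B_convex jump_bot_subset_jump_top[OF g(1)]])
    show "x \<otimes> y \<otimes> inv (y \<otimes> x) \<in> jump_bot g" if "x \<in> jump_top g" "y \<in> jump_top g" for x y
      using J.commutator_in_jump_bot that by blast
    show "S \<subseteq> jump_top g" by (auto simp: S_def)
    show "S \<inter> jump_bot g = {}" using J.Q_B J.B_inv by (auto simp: S_def)
    show "x \<otimes> y \<in> S" if "x \<in> S" "y \<in> S" for x y
      using that J.Q_mult[of "inv y" "inv x"] by (auto simp: S_def inv_mult_group)
    show "d \<otimes> x \<in> S" if "d \<in> jump_bot g" "x \<in> S" for d x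
      using that J.Q_mult_B[of "inv x" "inv d"] J.B_A by (auto simp: S_def inv_mult_group)
    show "x \<in> S \<or> inv x \<in> S" if "x \<in> jump_top g" "x \<notin> jump_bot g" for x
      using that J.Q_cases[OF that(1)] J.A_inv[OF that(1)] by (auto simp: S_def)
  qed
  \<comment> \<open>The reversal affects only elements of \<open>jump_top g\<close> outside
    \<open>jump_bot g\<close>, and \<open>F\<close> contains none.\<close>
  moreover have "((P - jump_top g) \<union> S \<union> (P \<inter> jump_bot g)) \<inter> F = P \<inter> F"
    using n J.B_A J.Q_B J.B_inv by (auto simp: S_def)
  ultimately have eq: "(P - jump_top g) \<union> S \<union> (P \<inter> jump_bot g) = P" by (rule isolated)
  have "x \<in> S \<longleftrightarrow> x \<in> P" if "x \<in> jump_top g" "x \<notin> jump_bot g" for x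
    using eq that by blast
  moreover have "inv g \<in> jump_top g" "inv g \<notin> jump_bot g"
    using self_in_jump_top self_notin_jump_bot subgroup_inv_iff[OF J.B_subgroup g(1)] by auto
  ultimately have "g \<in> S \<longleftrightarrow> g \<in> P" "inv g \<in> S \<longleftrightarrow> inv g \<in> P"
    using self_in_jump_top[of g] self_notin_jump_bot[of g] by blast+
  then have "inv g \<in> J.Q \<longleftrightarrow> g \<in> P" "g \<in> J.Q \<longleftrightarrow> inv g \<in> P"
    using g self_in_jump_top[of g] J.A_inv[of g] by (simp_all add: S_def)
  then show False using P_total[OF g] J.Q_P[of g] J.Q_P[of "inv g"] inv_notin_P[of g] by blast
qed

text \<open>Otherwise \<open>C/D\<close> would have an ordering different from the given one but agreeing with it
  on the image of \<open>F\<close>.\<close>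

lemma abelian_quotient_rank_one:
  assumes C: "convex C" and D: "convex D" and DC: "D \<subseteq> C"
    and comm: "\<And>x y. \<lbrakk>x \<in> C; y \<in> C\<rbrakk> \<Longrightarrow> x \<otimes> y \<otimes> inv (y \<otimes> x) \<in> D"
    and c: "c \<in> C" "c \<notin> D" and y: "y \<in> C"
  shows "\<exists>k\<ge>1::nat. \<exists>m::int. \<exists>z\<in>D. y [^] k = c [^] m \<otimes> z"
proof -
  note sC = convex_subgroup[OF C] and sD = convex_subgroup[OF D]
  let ?H = "G\<lparr>carrier := C\<rparr>"
  obtain V :: "'a set monoid" and p where V: "comm_group V" and ph: "group_hom ?H V p"
    and surj: "p ` C = carrier V" and ker: "\<And>x. x \<in> C \<Longrightarrow> p x = \<one>\<^bsub>V\<^esub> \<longleftrightarrow> x \<in> D"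
    using quotient_hom[OF sC sD DC comm] by metis
  interpret V: comm_group V by (rule V)
  interpret p: group_hom ?H V p by (rule ph)
  have Cc: "x \<in> carrier G" if "x \<in> C" for x using subgroup.mem_carrier[OF sC that] .
  have pc: "p x \<in> carrier V" if "x \<in> C" for x using surj that by blast
  have pm: "p (x \<otimes> y) = p x \<otimes>\<^bsub>V\<^esub> p y" if "x \<in> C" "y \<in> C" for x y
    using p.hom_mult[of x y] that by simp
  have pinv: "p (inv x) = inv\<^bsub>V\<^esub> (p x)" if "x \<in> C" for x
    using p.hom_inv[of x] that m_inv_consistent[OF sC that] by simp
  have ppow: "p (x [^] n) = p x [^]\<^bsub>V\<^esub> n" if "x \<in> C" for x and n :: nat
    using p.hom_nat_pow[of x n] that nat_pow_consistent[of x n C] by simp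
  have pipow: "p (x [^] n) = p x [^]\<^bsub>V\<^esub> n" if "x \<in> C" for x and n :: int
    using p.hom_int_pow[of x n] that int_pow_consistent[OF sC that] by simp
  have Cm: "x \<otimes> y \<in> C" if "x \<in> C" "y \<in> C" for x y using subgroup.m_closed[OF sC that] .
  have Ci: "inv x \<in> C" if "x \<in> C" for x using subgroup.m_inv_closed[OF sC that] .
  have Cpow: "x [^] n \<in> C" if "x \<in> C" for x and n :: nat
    by (induction n) (use that Cm subgroup.one_closed[OF sC] in auto)
  have Cipow: "x [^] n \<in> C" if "x \<in> C" for x and n :: int
    using p.G.int_pow_closed[of x n] that int_pow_consistent[OF sC that] by simp
  define N where "N = p ` {x \<in> C. x \<in> P \<or> x \<in> D}"
  have PD: "x \<otimes> y \<in> P \<or> x \<otimes> y \<in> D" if "x \<in> P \<or> x \<in> D" "y \<in> P \<or> y \<in> D" for x y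
    using that P_mult[of x y] subgroup.m_closed[OF sD, of x y] outside_mult_right[OF D, of x y]
      outside_mult_left[OF D, of y x] by blast
  have tf: "\<forall>v\<in>carrier V. \<forall>n\<ge>1::nat. v [^]\<^bsub>V\<^esub> n = \<one>\<^bsub>V\<^esub> \<longrightarrow> v = \<one>\<^bsub>V\<^esub>"
  proof (intro ballI allI impI)
    fix v and n :: nat assume v: "v \<in> carrier V" "1 \<le> n" "v [^]\<^bsub>V\<^esub> n = \<one>\<^bsub>V\<^esub>"
    obtain x where x: "x \<in> C" "v = p x" using v surj by blast
    then have "x [^] n \<in> D" using v ker[OF Cpow] ppow by metis
    then show "v = \<one>\<^bsub>V\<^esub>" using convex_pow_iff[OF D Cc[OF x(1)] v(2)] ker x by blast
  qed
  have N: "V.total_cone N" unfolding V.total_cone_def V.pointed_def V.submon_def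
  proof (intro conjI ballI impI)
    show "N \<subseteq> carrier V" using pc by (auto simp: N_def)
    show "\<one>\<^bsub>V\<^esub> \<in> N" unfolding N_def
      using ker[of \<one>] subgroup.one_closed[OF sC] subgroup.one_closed[OF sD] by (metis (mono_tags, lifting) image_eqI mem_Collect_eq)
  next
    fix u v assume "u \<in> N" "v \<in> N"
    then obtain x y where xy: "x \<in> C" "x \<in> P \<or> x \<in> D" "y \<in> C" "y \<in> P \<or> y \<in> D" "u = p x" "v = p y"
      by (auto simp: N_def)
    then have "u \<otimes>\<^bsub>V\<^esub> v = p (x \<otimes> y)" using pm by simp
    then show "u \<otimes>\<^bsub>V\<^esub> v \<in> N" unfolding N_def using PD[OF xy(2,4)] Cm[OF xy(1,3)] by blast
  next
    fix v assume v: "v \<in> N" "inv\<^bsub>V\<^esub> v \<in> N"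
    obtain x where x: "x \<in> C" "x \<in> P \<or> x \<in> D" "v = p x" using v(1) by (auto simp: N_def)
    obtain y where y: "y \<in> C" "y \<in> P \<or> y \<in> D" "inv\<^bsub>V\<^esub> v = p y" using v(2) by (auto simp: N_def)
    have "p (y \<otimes> x) = \<one>\<^bsub>V\<^esub>" using pm[OF y(1) x(1)] x y pc by (metis V.l_inv)
    then have yx: "y \<otimes> x \<in> D" using ker[OF Cm[OF y(1) x(1)]] by simp
    have "x \<in> D"
    proof (rule ccontr)
      assume nx: "x \<notin> D"
      then have "y \<notin> D" using subgroup_mult_iff(2)[OF sD, of y x] yx Cc[OF x(1)] by blast
      then have "y \<in> P" "x \<in> P" using x y nx by auto
      then show False using outside_mult(2)[OF D, of y x] nx yx by blast
    qed
    then show "v = \<one>\<^bsub>V\<^esub>" using ker x by blast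
  next
    fix v assume "v \<in> carrier V"
    then obtain x where x: "x \<in> C" "v = p x" using surj by blast
    have "x \<in> P \<or> x \<in> D \<or> inv x \<in> P"
      using P_total[OF Cc[OF x(1)]] subgroup.one_closed[OF sD] by blast
    then show "v \<in> N \<or> inv\<^bsub>V\<^esub> v \<in> N" unfolding N_def x(2) pinv[OF x(1), symmetric]
      using x(1) Ci[OF x(1)] by blast
  qed
  \<comment> \<open>A competing cone is only required to contain the image of \<open>E\<close>, so a
    negative element of \<open>F\<close> has to be recorded through its positive inverse.\<close>
  define E where "E = {x \<in> F \<union> m_inv G ` F. x \<in> C \<and> (x \<in> P \<or> x \<in> D)}"
  have EN: "p ` E \<subseteq> N" by (auto simp: E_def N_def)
  have Efin: "finite (p ` E)" using F_finite by (simp add: E_def)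
  have uniq: "\<forall>N'. V.total_cone N' \<and> p ` E \<subseteq> N' \<longrightarrow> N' = N"
  proof (intro allI impI)
    fix N' assume "V.total_cone N' \<and> p ` E \<subseteq> N'"
    then have N't: "V.total_cone N'" and EN': "p ` E \<subseteq> N'" by auto
    have sN': "V.submon N'" using N't by (simp add: V.total_cone_def V.pointed_def)
    have N'pt: "x \<in> D" if "x \<in> C" "p x \<in> N'" "p (inv x) \<in> N'" for x
      using that N't pinv[OF that(1)] ker[OF that(1)] by (simp add: V.total_cone_def V.pointed_def)
    \<comment> \<open>The competing cone \<open>N'\<close> is lifted to a modification of
      \<open>P\<close> with the same signs on \<open>F\<close>; isolation then returns
      \<open>N' = N\<close>.\<close>
    define S where "S = {x \<in> C. x \<notin> D \<and> p x \<in> N'}"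
    have "ccone G ((P - C) \<union> S \<union> (P \<inter> D))"
    proof (rule ccone_modify[OF C D DC comm])
      show "S \<subseteq> C" "S \<inter> D = {}" by (auto simp: S_def)
      fix x y assume xy: "x \<in> S" "y \<in> S"
      then have xyC: "x \<in> C" "y \<in> C" "x \<notin> D" "p x \<in> N'" "p y \<in> N'" by (auto simp: S_def)
      have pxy: "p (x \<otimes> y) \<in> N'" using V.submonD(3)[OF sN'] xyC pm by simp
      have "x \<otimes> y \<notin> D"
      proof
        assume "x \<otimes> y \<in> D"
        then have "p x \<otimes>\<^bsub>V\<^esub> p y = \<one>\<^bsub>V\<^esub>" using ker[OF Cm] pm xyC by simp
        then have "p y \<otimes>\<^bsub>V\<^esub> p x = \<one>\<^bsub>V\<^esub>" using V.m_comm pc xyC by simp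
        then have "inv\<^bsub>V\<^esub> (p x) = p y" using V.inv_equality pc xyC by blast
        then show False using N'pt[OF xyC(1,4)] pinv xyC by simp
      qed
      then show "x \<otimes> y \<in> S" using pxy xyC Cm by (simp add: S_def)
    next
      fix d x assume d: "d \<in> D" and x: "x \<in> S"
      have dx: "d \<in> C" "x \<in> C" "x \<notin> D" "p x \<in> N'" using d x DC by (auto simp: S_def)
      have "p (d \<otimes> x) = p x" using pm[OF dx(1,2)] ker[OF dx(1)] d pc[OF dx(2)] by simp
      then show "d \<otimes> x \<in> S"
        using dx Cm subgroup_mult_iff(2)[OF sD d Cc[OF dx(2)]] by (simp add: S_def)
    next
      fix x assume x: "x \<in> C" "x \<notin> D"
      have "p x \<in> N' \<or> inv\<^bsub>V\<^esub> (p x) \<in> N'" using N't pc[OF x(1)] by (simp add: V.total_cone_def)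
      then show "x \<in> S \<or> inv x \<in> S"
        using x Ci pinv subgroup_inv_iff[OF sD Cc[OF x(1)]] by (simp add: S_def)
    qed
    moreover have "((P - C) \<union> S \<union> (P \<inter> D)) \<inter> F = P \<inter> F"
    proof -
      have "f \<in> S \<longleftrightarrow> f \<in> P" if f: "f \<in> F" "f \<in> C" "f \<notin> D" for f
      proof
        assume "f \<in> P"
        then have "f \<in> E" using f by (simp add: E_def)
        then show "f \<in> S" using EN' f by (auto simp: S_def)
      next
        assume fS: "f \<in> S"
        show "f \<in> P"
        proof (rule ccontr)
          assume "f \<notin> P"
          then have "inv f \<in> P" using P_total[OF Cc[OF f(2)]] subgroup.one_closed[OF sD] f by blast
          then have "inv f \<in> E" using f Ci by (simp add: E_def)
          then show False using N'pt[OF f(2)] fS EN' f by (auto simp: S_def)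
        qed
      qed
      moreover have "S \<subseteq> C" "S \<inter> D = {}" by (auto simp: S_def)
      ultimately show ?thesis using DC by blast
    qed
    ultimately have eq: "(P - C) \<union> S \<union> (P \<inter> D) = P" by (rule isolated)
    have SP: "x \<in> S \<longleftrightarrow> x \<in> P" if "x \<in> C" "x \<notin> D" for x using eq that by blast
    have "p x \<in> N' \<longleftrightarrow> x \<in> P \<or> x \<in> D" if x: "x \<in> C" for x
    proof (cases "x \<in> D")
      case True then show ?thesis using ker[OF x] V.submonD(2)[OF sN'] by simp
    next
      case False then show ?thesis using SP[OF x False] x by (simp add: S_def)
    qed
    then have sub: "N \<subseteq> N'" "\<And>x. x \<in> C \<Longrightarrow> p x \<in> N' \<Longrightarrow> p x \<in> N" by (auto simp: N_def)
    have "N' \<subseteq> p ` C" using surj V.submonD(1)[OF sN'] by blast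
    then show "N' = N" using sub by blast
  qed
  have "p c \<noteq> \<one>\<^bsub>V\<^esub>" using ker c by blast
  then obtain k m where km: "k \<ge> 1" "p y [^]\<^bsub>V\<^esub> (k::nat) = p c [^]\<^bsub>V\<^esub> (m::int)"
    using V.unique_cone_rank_one[OF tf N EN Efin uniq pc[OF c(1)] _ pc[OF y]] by blast
  define z where "z = inv (c [^] m) \<otimes> y [^] k"
  have yk: "y [^] k \<in> C" and cm: "c [^] m \<in> C" using Cpow Cipow y c by auto
  have "p z = inv\<^bsub>V\<^esub> (p c [^]\<^bsub>V\<^esub> m) \<otimes>\<^bsub>V\<^esub> (p y [^]\<^bsub>V\<^esub> k)"
    unfolding z_def using pm[OF Ci[OF cm] yk] pinv[OF cm] pipow[OF c(1)] ppow[OF y] by simp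
  then have "p z = \<one>\<^bsub>V\<^esub>" using km pc[OF c(1)] by simp
  then have "z \<in> D" using ker[of z] Cm[OF Ci[OF cm] yk] by (simp add: z_def)
  moreover have "y [^] k = c [^] m \<otimes> z" using Cc[OF cm] Cc[OF yk] by (simp add: z_def)
  ultimately show ?thesis using km by blast
qed

lemma jump_rank_one:
  assumes g: "g \<in> carrier G" "g \<noteq> \<one>" and c: "c \<in> jump_top g" "c \<notin> jump_bot g" and y: "y \<in> jump_top g"
  shows "\<exists>k\<ge>1::nat. \<exists>m::int. \<exists>z\<in>jump_bot g. y [^] k = c [^] m \<otimes> z"
proof -
  interpret J: cjump G P g by unfold_locales (use g in auto)
  show ?thesis
    by (rule abelian_quotient_rank_one[OF J.A_convex J.B_convex jump_bot_subset_jump_top[OF g(1)] _ c y])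
      (rule J.commutator_in_jump_bot)
qed

text \<open>An abelian quotient over \<open>jump_bot h\<close> would have rank one, making a power
  of \<open>f\<close> a power of \<open>h\<close> times an element of \<open>jump_bot h\<close>.
  Closure of \<open>jump_bot f\<close> under roots would then give
  \<open>f \<in> jump_bot f\<close>.\<close>

lemma consecutive_jumps_noncommutative:
  assumes f: "f \<in> carrier G" "f \<noteq> \<one>" and h: "h \<in> jump_bot f" "h \<noteq> \<one>"
  shows "\<exists>a\<in>jump_top f. \<exists>b\<in>jump_top f. a \<otimes> b \<otimes> inv (b \<otimes> a) \<notin> jump_bot h"
proof (rule ccontr)
  assume n: "\<not> ?thesis"
  note cf = convex_jump_bot[OF f] and sf = convex_subgroup[OF convex_jump_bot[OF f]]
  have hc: "h \<in> carrier G" using h subgroup.mem_carrier[OF sf] by blast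
  have sub: "jump_bot h \<subseteq> jump_bot f"
    using jump_bot_subset_jump_top[OF hc] jump_top_least[OF cf h(1)] by blast
  have "\<exists>k\<ge>1::nat. \<exists>m::int. \<exists>z\<in>jump_bot h. f [^] k = h [^] m \<otimes> z"
    by (rule abelian_quotient_rank_one[OF convex_jump_top[OF f(1)] convex_jump_bot[OF hc h(2)]])
      (use sub jump_bot_subset_jump_top[OF f(1)] n h self_notin_jump_bot self_in_jump_top in auto)
  then obtain k m z where k: "k \<ge> 1" "z \<in> jump_bot h" "f [^] (k::nat) = h [^] (m::int) \<otimes> z" by blast
  then have "f [^] k \<in> jump_bot f"
    using subgroup.m_closed[OF sf] int_pow_in_subgroup[OF sf h(1)] sub by auto
  then show False using convex_pow_iff[OF cf f(1) k(1)] self_notin_jump_bot by blast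
qed

lemma jump_top_in_F:
  assumes "g \<in> carrier G" "g \<noteq> \<one>"
  shows "\<exists>f\<in>F. f \<noteq> \<one> \<and> jump_top f = jump_top g \<and> jump_bot f = jump_bot g"
proof -
  obtain f where f: "f \<in> F" "f \<in> jump_top g" "f \<notin> jump_bot g" using jump_meets_F[OF assms] by blast
  moreover have "f \<noteq> \<one>" using f subgroup.one_closed[OF convex_subgroup[OF convex_jump_bot[OF assms]]] by blast
  ultimately show ?thesis using jump_eq[OF assms(1)] by blast
qed

text \<open>Every jump is represented in the finite set \<open>F\<close>; this permits minimal
  counterexamples along the chain of jumps.\<close>

lemma minimal_jump_top:
  assumes "Y \<noteq> {}" "Y \<subseteq> carrier G - {\<one>}"
  shows "\<exists>y\<in>Y. \<forall>w\<in>Y. jump_top w \<subseteq> jump_top y \<longrightarrow> jump_top w = jump_top y"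
proof -
  have "jump_top y \<in> jump_top ` F" if "y \<in> Y" for y
    using jump_top_in_F[of y] assms(2) that by (metis DiffD1 DiffD2 imageI insertI1 subsetD)
  then have "jump_top ` Y \<subseteq> jump_top ` F" by blast
  then have "finite (jump_top ` Y)" using F_finite finite_subset by blast
  then have "\<exists>M\<in>jump_top ` Y. \<forall>H\<in>jump_top ` Y. H \<subseteq> M \<longrightarrow> M = H"
    using finite_has_minimal[of "jump_top ` Y"] assms(1) by simp
  then obtain y where y: "y \<in> Y" "\<forall>H\<in>jump_top ` Y. H \<subseteq> jump_top y \<longrightarrow> jump_top y = H"
    by (elim bexE imageE) simp
  show ?thesis
  proof (intro bexI[OF _ y(1)] ballI impI)
    fix w assume w: "w \<in> Y" "jump_top w \<subseteq> jump_top y"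
    then have "jump_top y = jump_top w" using y(2) by blast
    then show "jump_top w = jump_top y" by (rule sym)
  qed
qed

text \<open>Among the elements above \<open>y\<close> within \<open>jump_top f\<close>, one of
  lowest jump sits directly above \<open>y\<close>: anything strictly between would be a lower
  candidate. It is replaced by a representative in \<open>F\<close> so that finitely many witness
  pairs serve all jumps.\<close>

lemma next_jump:
  assumes f: "f \<in> carrier G" "f \<noteq> \<one>" and y: "y \<in> jump_bot f" "y \<noteq> \<one>"
  shows "\<exists>h\<in>F. h \<noteq> \<one> \<and> jump_top h \<subseteq> jump_top f \<and> jump_bot h = jump_top y"
proof -
  define Y where "Y = {h \<in> jump_top f. y \<in> jump_bot h \<and> h \<noteq> \<one>}"
  have sf: "subgroup (jump_top f) G" using convex_subgroup[OF convex_jump_top[OF f(1)]] .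
  have Yne: "Y \<noteq> {}" using f y self_in_jump_top[of f] by (auto simp: Y_def)
  have Yc: "Y \<subseteq> carrier G - {\<one>}" using subgroup.mem_carrier[OF sf] by (auto simp: Y_def)
  obtain h where h: "h \<in> Y" and hmin: "\<And>w. w \<in> Y \<Longrightarrow> jump_top w \<subseteq> jump_top h \<Longrightarrow> jump_top w = jump_top h"
    using minimal_jump_top[OF Yne Yc] by blast
  have hc: "h \<in> carrier G" "h \<noteq> \<one>" using h Yc by auto
  note ch = convex_jump_bot[OF hc]
  have yc: "y \<in> carrier G" using y subgroup.mem_carrier[OF convex_subgroup[OF convex_jump_bot[OF f]]] by blast
  have hf: "jump_top h \<subseteq> jump_top f" using h jump_top_least[OF convex_jump_top[OF f(1)]] by (auto simp: Y_def)
  have "jump_top y \<subseteq> jump_bot h" using jump_top_least[OF ch] h by (auto simp: Y_def)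
  moreover have "w \<in> jump_top y" if w: "w \<in> jump_bot h" for w
  proof (rule ccontr)
    assume nw: "w \<notin> jump_top y"
    then have yw: "y \<in> jump_bot w" using jump_bot_greatest[OF convex_jump_top[OF yc]] self_in_jump_top by blast
    have w1: "w \<noteq> \<one>" using nw subgroup.one_closed[OF convex_subgroup[OF convex_jump_top[OF yc]]] by blast
    have wh: "jump_top w \<subseteq> jump_bot h" using jump_top_least[OF ch w] .
    then have wh': "jump_top w \<subseteq> jump_top h" using jump_bot_subset_jump_top[OF hc(1)] by blast
    then have "w \<in> Y" using self_in_jump_top[of w] hf yw w1 by (auto simp: Y_def)
    then have "jump_top w = jump_top h" using hmin wh' by blast
    then show False using wh self_in_jump_top[of h] self_notin_jump_bot by blast
  qed
  ultimately have "jump_bot h = jump_top y" by blast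
  then show ?thesis using jump_top_in_F[OF hc] hf by metis
qed

text \<open>Take finitely many elements of \<open>jump_top f\<close>, including pairs witnessing that the quotients over
  consecutive jumps of \<open>P\<close> are not abelian, and a \<open>P1\<close>-jump \<open>C/K\<close> with all of them in \<open>C\<close>. As
  \<open>C/K\<close> is abelian, \<open>K\<close> contains the commutators of these pairs, and since the jumps of \<open>P\<close> have rank
  one, \<open>K\<close> then contains \<open>C \<inter> jump_bot f\<close>.\<close>

lemma lower_jumps_collapse:
  assumes P1: "ccone G P1" and f: "f \<in> carrier G" "f \<noteq> \<one>" and z: "z \<in> jump_bot f"
  shows "\<exists>K. ccone.convex G P1 K \<and> z \<in> K \<and> f \<notin> K"
proof -
  interpret q: ccone G P1 by (rule P1)
  have "\<exists>ab. fst ab \<in> jump_top h \<and> snd ab \<in> jump_top h \<and>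
      fst ab \<otimes> snd ab \<otimes> inv (snd ab \<otimes> fst ab) \<notin> jump_bot e"
    if "h \<in> F" "h \<noteq> \<one>" "e \<in> jump_bot h" "e \<noteq> \<one>" for h e
    using consecutive_jumps_noncommutative[of h e] that F_carrier by auto
  then obtain w where w: "\<And>h e. \<lbrakk>h \<in> F; h \<noteq> \<one>; e \<in> jump_bot h; e \<noteq> \<one>\<rbrakk> \<Longrightarrow>
      fst (w h e) \<in> jump_top h \<and> snd (w h e) \<in> jump_top h \<and>
      fst (w h e) \<otimes> snd (w h e) \<otimes> inv (snd (w h e) \<otimes> fst (w h e)) \<notin> jump_bot e"
    by metis
  \<comment> \<open>Indexing the witnesses by representatives in \<open>F\<close> keeps them finite
    in number while covering every pair of jumps.\<close>
  define W where "W = (\<lambda>(h, e). w h e) ` (F \<times> F)"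
  define T where "T = ({f, z} \<union> fst ` W \<union> snd ` W) \<inter> jump_top f"
  note sf = convex_subgroup[OF convex_jump_top[OF f(1)]]
  have fc: "x \<in> carrier G" if "x \<in> jump_top f" for x using subgroup.mem_carrier[OF sf that] .
  have Tfin: "finite T" unfolding T_def W_def using F_finite by auto
  have Tc: "T \<subseteq> carrier G" using fc by (auto simp: T_def)
  have fT: "f \<in> T" and zT: "z \<in> T"
    using self_in_jump_top jump_bot_subset_jump_top[OF f(1)] z by (auto simp: T_def)
  obtain s where s: "s \<in> T" "T \<subseteq> q.jump_top s" using q.finite_jump_top_bound[OF Tfin _ Tc] fT by blast
  have sc: "s \<in> carrier G" using s Tc by blast
  have s1: "s \<noteq> \<one>" using s fT f q.jump_top_one by auto
  interpret J: cjump G P1 s by unfold_locales (use sc s1 in auto)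
  define K where "K = q.jump_bot s"
  \<comment> \<open>The \<open>P1\<close>-jump is cut down to \<open>jump_top f\<close>, so that
    rank one for \<open>P\<close> and commutators for \<open>P1\<close> apply to the same elements.
    \<open>K\<close> itself need not lie in \<open>C\<close>.\<close>
  define C where "C = q.jump_top s \<inter> jump_top f"
  have K: "q.convex K" unfolding K_def by (rule J.B_convex)
  have sC: "subgroup C G" unfolding C_def by (rule subgroups_Inter_pair[OF J.A_subgroup sf])
  have sK: "subgroup K G" using q.convex_subgroup[OF K] .
  have TC: "T \<subseteq> C" using s by (auto simp: C_def T_def)
  have Cc: "x \<in> carrier G" if "x \<in> C" for x using subgroup.mem_carrier[OF sC that] .
  have commK: "x \<otimes> y \<otimes> inv (y \<otimes> x) \<in> K" if "x \<in> C" "y \<in> C" for x y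
    using J.commutator_in_jump_bot that by (simp add: K_def C_def)
  \<comment> \<open>Membership in \<open>K\<close> passes along \<open>y^k = c^m v\<close>. The
    relation itself forces \<open>v \<in> C\<close>, so \<open>v \<in> K\<close> has to be known
    only under that condition.\<close>
  have root: "y \<in> K" if "y \<in> C" "c \<in> C" "c \<in> K" "k \<ge> 1" "y [^] (k::nat) = c [^] (m::int) \<otimes> v"
    "v \<in> carrier G" "v \<in> C \<Longrightarrow> v \<in> K" for y c k m v
  proof -
    have yk: "y [^] k \<in> C"
      using int_pow_in_subgroup[OF sC that(1), of "int k"] by (simp add: int_pow_int)
    have cmC: "c [^] m \<in> C" and cmK: "c [^] m \<in> K"
      using int_pow_in_subgroup sC sK that(2,3) by auto
    have "v \<in> C" using subgroup_mult_iff(2)[OF sC cmC that(6)] yk that(5) by simp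
    then have "y [^] k \<in> K" using subgroup.m_closed[OF sK cmK] that by simp
    then show ?thesis using q.convex_pow_iff[OF K Cc[OF that(1)] that(4)] by simp
  qed
  have jump_botK: "C \<inter> jump_bot f \<subseteq> K"
  proof (rule ccontr)
    assume ncK: "\<not> C \<inter> jump_bot f \<subseteq> K"
    \<comment> \<open>A counterexample \<open>y\<close> of lowest \<open>P\<close>-jump is refuted:
      the commutator \<open>c\<close> of the witness pair for the jump of \<open>y\<close> and the
      next one lies in \<open>K\<close>, and rank one gives \<open>y^k = c^m v\<close> with
      \<open>v\<close> in lower jumps, where minimality applies.\<close>
    define Y where "Y = C \<inter> jump_bot f - K"
    have one: "\<one> \<in> K" using subgroup.one_closed[OF sK] .
    have Yne: "Y \<noteq> {}" and Yc: "Y \<subseteq> carrier G - {\<one>}"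
      using ncK Cc one by (auto simp: Y_def)
    obtain y where y: "y \<in> Y" and ymin: "\<And>v. v \<in> Y \<Longrightarrow> jump_top v \<subseteq> jump_top y \<Longrightarrow> jump_top v = jump_top y"
      using minimal_jump_top[OF Yne Yc] by blast
    have yY: "y \<in> C" "y \<in> jump_bot f" "y \<notin> K" using y by (auto simp: Y_def)
    have yc: "y \<in> carrier G" "y \<noteq> \<one>" using Cc yY one by auto
    obtain h where h: "h \<in> F" "h \<noteq> \<one>" "jump_top h \<subseteq> jump_top f" "jump_bot h = jump_top y"
      using next_jump[OF f yY(2) yc(2)] by blast
    obtain e where e: "e \<in> F" "e \<noteq> \<one>" "jump_top e = jump_top y" "jump_bot e = jump_bot y"
      using jump_top_in_F[OF yc] by blast
    have eh: "e \<in> jump_bot h" using h(4) e(3) self_in_jump_top by metis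
    define a where "a = fst (w h e)"
    define b where "b = snd (w h e)"
    have ab: "a \<in> jump_top h" "b \<in> jump_top h" "a \<otimes> b \<otimes> inv (b \<otimes> a) \<notin> jump_bot y"
      using w[OF h(1,2) eh e(2)] e(4) unfolding a_def b_def by auto
    have "w h e \<in> W" unfolding W_def using h(1) e(1) by force
    then have "a \<in> T" "b \<in> T" unfolding T_def a_def b_def using ab h(3) by (auto simp: a_def b_def)
    then have abC: "a \<in> C" "b \<in> C" using TC by auto
    define c where "c = a \<otimes> b \<otimes> inv (b \<otimes> a)"
    have cC: "c \<in> C" unfolding c_def
      using abC subgroup.m_closed[OF sC] subgroup.m_inv_closed[OF sC] by blast
    have cK: "c \<in> K" unfolding c_def using commK abC by blast
    have hc: "h \<in> carrier G" using h F_carrier by blast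
    interpret Jh: cjump G P h by unfold_locales (use hc h in auto)
    have cy: "c \<in> jump_top y" "c \<notin> jump_bot y"
      using Jh.commutator_in_jump_bot[OF ab(1,2)] ab(3) h(4) by (auto simp: c_def)
    obtain k m v where km: "k \<ge> 1" "v \<in> jump_bot y" "y [^] (k::nat) = c [^] (m::int) \<otimes> v"
      using jump_rank_one[OF yc cy self_in_jump_top] by blast
    note cory = convex_jump_bot[OF yc]
    have vc: "v \<in> carrier G" using subgroup.mem_carrier[OF convex_subgroup[OF cory] km(2)] .
    have "v \<in> K" if vC: "v \<in> C"
    proof (rule ccontr)
      assume "v \<notin> K"
      moreover have "jump_bot y \<subseteq> jump_bot f"
        using jump_bot_subset_jump_top[OF yc(1)] jump_top_least[OF convex_jump_bot[OF f] yY(2)] by blast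
      ultimately have "v \<in> Y" using vC km(2) by (auto simp: Y_def)
      moreover have vy: "jump_top v \<subseteq> jump_bot y" using jump_top_least[OF cory km(2)] .
      ultimately have "jump_top v = jump_top y" using ymin jump_bot_subset_jump_top[OF yc(1)] by blast
      then show False using vy self_in_jump_top[of y] self_notin_jump_bot by blast
    qed
    then have "y \<in> K" using root[OF yY(1) cC cK km(1,3) vc] by blast
    then show False using yY by blast
  qed
  have sK': "s \<notin> K" using q.self_notin_jump_bot by (simp add: K_def)
  have sC': "s \<in> C" using s TC by blast
  \<comment> \<open>As \<open>s\<close> is outside \<open>K\<close>, it cannot lie in
    \<open>jump_bot f\<close>. So it belongs to the \<open>P\<close>-jump of \<open>f\<close>, and
    \<open>f \<in> K\<close> would carry \<open>s\<close> into \<open>K\<close>.\<close>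
  have "f \<notin> K"
  proof
    assume fK: "f \<in> K"
    have "s \<in> jump_top f" "s \<notin> jump_bot f" using s jump_botK sK' sC' by (auto simp: T_def)
    then obtain k m v where km: "k \<ge> 1" "v \<in> jump_bot f" "s [^] (k::nat) = f [^] (m::int) \<otimes> v"
      using jump_rank_one[OF f self_in_jump_top self_notin_jump_bot] by blast
    have vc: "v \<in> carrier G" using subgroup.mem_carrier[OF convex_subgroup[OF convex_jump_bot[OF f]] km(2)] .
    have "s \<in> K" using root[OF sC' _ fK km(1,3) vc] jump_botK km(2) fT TC by blast
    then show False using sK' by blast
  qed
  moreover have "z \<in> K" using zT TC jump_botK z by blast
  ultimately show ?thesis using K by blast
qed

text \<open>Rank one gives \<open>x^k = f^m z\<close> with \<open>f \<in> F\<close> in the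
  \<open>P\<close>-jump of \<open>x\<close> and \<open>z\<close> below it. Every cone
  \<open>P1\<close> has a convex subgroup containing \<open>z\<close> but not \<open>f\<close>, so
  \<open>z\<close> does not affect the sign of \<open>f^m\<close>. Neither \<open>f\<close> nor
  \<open>m\<close> depends on \<open>P1\<close>; \<open>f0\<close> absorbs the sign of
  \<open>m\<close>.\<close>

lemma sign_determined:
  assumes x: "x \<in> carrier G" "x \<noteq> \<one>"
  shows "\<exists>f0 \<in> F \<union> m_inv G ` F. f0 \<noteq> \<one> \<and> (\<forall>P1. ccone G P1 \<longrightarrow> (x \<in> P1 \<longleftrightarrow> f0 \<in> P1))"
proof -
  obtain f where f: "f \<in> F" "f \<noteq> \<one>" "jump_top f = jump_top x" "jump_bot f = jump_bot x"
    using jump_top_in_F[OF x] by blast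
  have fc: "f \<in> carrier G" using f F_carrier by blast
  obtain k m z where km: "k \<ge> 1" "z \<in> jump_bot x" "x [^] (k::nat) = f [^] (m::int) \<otimes> z"
    using jump_rank_one[OF x _ _ self_in_jump_top, of f] f self_in_jump_top self_notin_jump_bot by metis
  have zf: "z \<in> jump_bot f" using km f by simp
  have zc: "z \<in> carrier G"
    using subgroup.mem_carrier[OF convex_subgroup[OF convex_jump_bot[OF x]] km(2)] .
  have m0: "m \<noteq> 0"
  proof
    assume "m = 0"
    then have "x [^] k \<in> jump_bot x" using km zc by simp
    then show False using convex_pow_iff[OF convex_jump_bot[OF x] x(1) km(1)] self_notin_jump_bot by blast
  qed
  define f0 where "f0 = (if m > 0 then f else inv f)"
  define n where "n = nat \<bar>m\<bar>"
  have n1: "n \<ge> 1" using m0 by (simp add: n_def)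
  have f0c: "f0 \<in> carrier G" using fc by (simp add: f0_def)
  have fm: "f [^] m = f0 [^] n"
  proof (cases "m > 0")
    case True
    then have "m = int n" by (simp add: n_def)
    then show ?thesis using True by (simp add: f0_def int_pow_int)
  next
    case False
    then have "m = - int n" by (simp add: n_def)
    then show ?thesis using False fc by (simp add: f0_def int_pow_neg_int nat_pow_inv)
  qed
  have "x \<in> P1 \<longleftrightarrow> f0 \<in> P1" if P1: "ccone G P1" for P1
  proof -
    interpret q: ccone G P1 by (rule P1)
    obtain K where K: "q.convex K" "z \<in> K" "f \<notin> K"
      using lower_jumps_collapse[OF P1 fc f(2) zf] by blast
    note sK = q.convex_subgroup[OF K(1)]
    have f0K: "f0 \<notin> K" using K subgroup_inv_iff[OF sK fc] by (simp add: f0_def)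
    have pos: "x \<in> P1" if "f0 \<in> P1"
    proof -
      have "f0 [^] n \<in> P1" "f0 [^] n \<notin> K"
        using q.P_pow[OF that n1] q.convex_pow_iff[OF K(1) f0c n1] f0K by auto
      then have "x [^] k \<in> P1" using q.outside_mult_right[OF K(1) _ _ K(2)] km(3) fm by simp
      then show ?thesis using q.pow_in_P_iff[OF x(1) km(1)] by simp
    qed
    have neg: "inv x \<in> P1" if "inv f0 \<in> P1"
    proof -
      have i: "inv f0 [^] n \<in> P1" "inv f0 [^] n \<notin> K"
        using q.P_pow[OF that n1] q.convex_pow_iff[OF K(1) _ n1, of "inv f0"] f0K f0c
          subgroup_inv_iff[OF sK f0c] by auto
      have "inv z \<otimes> inv f0 [^] n \<in> P1"
        using q.outside_mult_left[OF K(1) i subgroup.m_inv_closed[OF sK K(2)]] .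
      also have "inv z \<otimes> inv f0 [^] n = inv x [^] k"
        using km(3) fm zc f0c x by (simp add: nat_pow_inv inv_mult_group)
      finally show ?thesis using q.pow_in_P_iff[of "inv x" k] x km(1) by simp
    qed
    show ?thesis
    proof (cases "f0 \<in> P1")
      case True then show ?thesis using pos by simp
    next
      case False
      have "f0 \<noteq> \<one>" using f0K subgroup.one_closed[OF sK] by blast
      then have "inv f0 \<in> P1" using q.P_total[OF f0c] False by blast
      then show ?thesis using neg q.inv_notin_P[of x] False by blast
    qed
  qed
  moreover have "f0 \<in> F \<union> m_inv G ` F" using f by (simp add: f0_def)
  moreover have "f0 \<noteq> \<one>" using f fc by (simp add: f0_def inv_eq_1_iff)
  ultimately show ?thesis by blast
qed

lemma ccone_determined_by_F:
  assumes P1: "ccone G P1" and P2: "ccone G P2" and eq: "P1 \<inter> F = P2 \<inter> F"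
  shows "P1 \<subseteq> P2"
proof
  interpret q1: ccone G P1 by (rule P1)
  interpret q2: ccone G P2 by (rule P2)
  fix x assume x: "x \<in> P1"
  have xc: "x \<in> carrier G" "x \<noteq> \<one>" using q1.P_carrier[OF x] x q1.one_notin_P by metis+
  obtain f0 where f0: "f0 \<in> F \<union> m_inv G ` F" "f0 \<noteq> \<one>" "\<forall>P1. ccone G P1 \<longrightarrow> (x \<in> P1 \<longleftrightarrow> f0 \<in> P1)"
    using sign_determined[OF xc] by blast
  have f0P1: "f0 \<in> P1" using f0(3) P1 x by blast
  have "f0 \<in> P2"
  proof (cases "f0 \<in> F")
    case True then show ?thesis using f0P1 eq by blast
  next
    case False
    then obtain f where f: "f \<in> F" "f0 = inv f" using f0 by blast
    have fc: "f \<in> carrier G" "f \<noteq> \<one>" using f F_carrier f0(2) by auto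
    have "f \<notin> P1" using q1.inv_notin_P f0P1 f by blast
    then have "f \<notin> P2" using eq f by blast
    then show ?thesis using q2.P_total[OF fc] f by blast
  qed
  then show "x \<in> P2" using f0(3) P2 by blast
qed

end

section \<open>Compactness\<close>

lemma ccone_pos:
  fixes G (structure)
  assumes "group G" and R: "R \<in> CO G"
  shows "ccone G (pos G R)"
    and "R = {(x, y). x \<in> carrier G \<and> y \<in> carrier G \<and> (x = y \<or> inv x \<otimes> y \<in> pos G R)}"
proof -
  interpret group G by fact
  have sub: "R \<subseteq> carrier G \<times> carrier G" and refl: "\<And>x. x \<in> carrier G \<Longrightarrow> (x, x) \<in> R"
    and anti: "\<And>x y. (x, y) \<in> R \<Longrightarrow> (y, x) \<in> R \<Longrightarrow> x = y"
    and tr: "\<And>x y z. (x, y) \<in> R \<Longrightarrow> (y, z) \<in> R \<Longrightarrow> (x, z) \<in> R"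
    and tot: "\<And>x y. x \<in> carrier G \<Longrightarrow> y \<in> carrier G \<Longrightarrow> x \<noteq> y \<Longrightarrow> (x, y) \<in> R \<or> (y, x) \<in> R"
    and inva: "\<And>g x y. g \<in> carrier G \<Longrightarrow> (x, y) \<in> R \<Longrightarrow> (g \<otimes> x, g \<otimes> y) \<in> R"
    using R unfolding CO_def C_ordering_def left_ordering_def
    by (auto simp: antisym_def trans_def total_on_def)
  have conr: "\<exists>n\<ge>1::nat. sless R g (f \<otimes> g [^] n)" if "f \<in> pos G R" "g \<in> pos G R" for f g
    using R that unfolding CO_def C_ordering_def pos_def by blast
  have posD: "x \<in> carrier G" "(\<one>, x) \<in> R" "x \<noteq> \<one>" if "x \<in> pos G R" for x
    using that by (auto simp: pos_def sless_def)
  have posI: "x \<in> pos G R" if "(\<one>, x) \<in> R" "x \<noteq> \<one>" for x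
    using that sub by (auto simp: pos_def sless_def)
  have less: "inv x \<otimes> y \<in> pos G R \<longleftrightarrow> (x, y) \<in> R \<and> x \<noteq> y" if xy: "x \<in> carrier G" "y \<in> carrier G" for x y
  proof
    assume a: "inv x \<otimes> y \<in> pos G R"
    have "(x \<otimes> \<one>, x \<otimes> (inv x \<otimes> y)) \<in> R" using inva posD(2)[OF a] xy by blast
    then show "(x, y) \<in> R \<and> x \<noteq> y" using xy posD(3)[OF a] by auto
  next
    assume a: "(x, y) \<in> R \<and> x \<noteq> y"
    then have r: "(inv x \<otimes> x, inv x \<otimes> y) \<in> R" using inva xy by blast
    have "inv x \<otimes> y \<noteq> \<one>"
    proof
      assume "inv x \<otimes> y = \<one>"
      then have "x \<otimes> (inv x \<otimes> y) = x" using xy by simp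
      then show False using a xy by simp
    qed
    then show "inv x \<otimes> y \<in> pos G R" using posI r xy by simp
  qed
  show "ccone G (pos G R)"
  proof
    show "pos G R \<subseteq> carrier G" using posD by blast
    show "\<one> \<notin> pos G R" using posD(3) by blast
  next
    fix x y assume x: "x \<in> pos G R" and y: "y \<in> pos G R"
    have xR: "(x, x \<otimes> y) \<in> R" using inva[OF posD(1)[OF x] posD(2)[OF y]] posD[OF x] by simp
    then have "(\<one>, x \<otimes> y) \<in> R" using tr posD(2)[OF x] by blast
    moreover have "x \<otimes> y \<noteq> \<one>" using anti[OF posD(2)[OF x]] xR posD(3)[OF x] by auto
    ultimately show "x \<otimes> y \<in> pos G R" by (rule posI)
  next
    fix x assume x: "x \<in> carrier G" "x \<noteq> \<one>"
    show "x \<in> pos G R \<or> inv x \<in> pos G R"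
      using tot[OF x(1) one_closed x(2)] less[OF x(1) one_closed] less[OF one_closed x(1)] x by auto
  next
    fix f g assume fg: "f \<in> pos G R" "g \<in> pos G R"
    then obtain n where "n \<ge> 1" "sless R g (f \<otimes> g [^] (n::nat))" using conr by blast
    then show "\<exists>n\<ge>1::nat. inv g \<otimes> (f \<otimes> g [^] n) \<in> pos G R"
      using less[of g "f \<otimes> g [^] n"] posD(1) fg by (auto simp: sless_def)
  qed
  have mem: "(x, y) \<in> R \<longleftrightarrow> x \<in> carrier G \<and> y \<in> carrier G \<and> (x = y \<or> inv x \<otimes> y \<in> pos G R)" for x y
    using sub refl less by blast
  show "R = {(x, y). x \<in> carrier G \<and> y \<in> carrier G \<and> (x = y \<or> inv x \<otimes> y \<in> pos G R)}"
    using mem by auto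
qed

lemma (in ccone) exists_ordering: "\<exists>R\<in>CO G. pos G R = P"
proof -
  define R where "R = {(x, y). x \<in> carrier G \<and> y \<in> carrier G \<and> (x = y \<or> inv x \<otimes> y \<in> P)}"
  have less: "sless R x y \<longleftrightarrow> inv x \<otimes> y \<in> P" if "x \<in> carrier G" "y \<in> carrier G" for x y
    using that one_notin_P by (auto simp: sless_def R_def)
  have tr: "inv x \<otimes> z \<in> P"
    if "x \<in> carrier G" "y \<in> carrier G" "z \<in> carrier G" "inv x \<otimes> y \<in> P" "inv y \<otimes> z \<in> P" for x y z
    using P_mult[OF that(4,5)] that(1-3) by (simp add: m_assoc)
  have i: "inv (inv x \<otimes> y) = inv y \<otimes> x" if "x \<in> carrier G" "y \<in> carrier G" for x y
    using that by (simp add: inv_mult_group)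
  have "left_ordering G R" unfolding left_ordering_def
  proof (intro conjI ballI allI impI)
    show "antisym R"
    proof (rule antisymI)
      fix x y assume xy: "(x, y) \<in> R" "(y, x) \<in> R"
      then show "x = y" using inv_notin_P[of "inv x \<otimes> y"] i[of x y] by (auto simp: R_def)
    qed
    show "trans R"
    proof (rule transI)
      fix x y z assume "(x, y) \<in> R" "(y, z) \<in> R"
      then show "(x, z) \<in> R" using tr[of x y z] by (auto simp: R_def)
    qed
    show "total_on (carrier G) R"
    proof (rule total_onI)
      fix x y assume xy: "x \<in> carrier G" "y \<in> carrier G" "x \<noteq> y"
      have "inv x \<otimes> y \<noteq> \<one>"
      proof
        assume "inv x \<otimes> y = \<one>"
        then have "x \<otimes> (inv x \<otimes> y) = x" using xy by simp
        then show False using xy by simp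
      qed
      then show "(x, y) \<in> R \<or> (y, x) \<in> R"
        using P_total[of "inv x \<otimes> y"] i[of x y] xy by (auto simp: R_def)
    qed
    fix g x y assume "g \<in> carrier G" "(x, y) \<in> R"
    then show "(g \<otimes> x, g \<otimes> y) \<in> R" by (auto simp: R_def inv_mult_group m_assoc)
  qed (auto simp: R_def)
  moreover have "\<exists>n\<ge>1::nat. sless R g (f \<otimes> g [^] n)"
    if "f \<in> carrier G" "g \<in> carrier G" "sless R \<one> f \<and> sless R \<one> g" for f g
    using that P_conrad[of f g] by (simp add: less)
  ultimately have "R \<in> CO G" by (simp add: CO_def C_ordering_def)
  moreover have "pos G R = P" using less P_sub by (auto simp: pos_def)
  ultimately show ?thesis by blast
qed

text \<open>Suppose \<open>f g\<^sup>2 < g\<close> and put \<open>h = f g\<close>. Then \<open>h\<^sup>n < h\<^sup>n g < g\<close> for all \<open>n\<close>, so \<open>f h\<^sup>n < h\<close>,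
  contradicting the Conrad property. Unlike the original property, the conclusion is a closed
  condition on \<open>P\<close>.\<close>

lemma (in ccone) conrad_square:
  assumes f: "f \<in> P" and g: "g \<in> P"
  shows "inv g \<otimes> (f \<otimes> (g \<otimes> g)) \<in> P"
proof (rule ccontr)
  assume n: "inv g \<otimes> (f \<otimes> (g \<otimes> g)) \<notin> P"
  have fc: "f \<in> carrier G" and gc: "g \<in> carrier G" using f g by auto
  have ne: "inv g \<otimes> (f \<otimes> (g \<otimes> g)) \<noteq> \<one>"
  proof
    assume "inv g \<otimes> (f \<otimes> (g \<otimes> g)) = \<one>"
    then have "g \<otimes> (inv g \<otimes> (f \<otimes> (g \<otimes> g))) = g" using gc by simp
    then have "(f \<otimes> g) \<otimes> g = \<one> \<otimes> g" using fc gc by (simp add: m_assoc)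
    then have "f \<otimes> g = \<one>" using fc gc by (metis m_closed one_closed right_cancel)
    then show False using P_mult[OF f g] one_notin_P by simp
  qed
  define h where "h = f \<otimes> g"
  have h: "h \<in> P" unfolding h_def using P_mult f g by blast
  have hc: "h \<in> carrier G" using h by simp
  have "inv (inv g \<otimes> (f \<otimes> (g \<otimes> g))) \<in> P"
    using P_total[OF _ ne] n fc gc by simp
  then have hg: "inv (h \<otimes> g) \<otimes> g \<in> P" using fc gc by (simp add: h_def m_assoc inv_mult_group)
  have step: "inv (h [^] n \<otimes> g) \<otimes> g \<in> P" if "n \<ge> 1" for n :: nat
    using that
  proof (induction n rule: dec_induct)
    case base then show ?case using hg hc by simp
  next
    case (step n)
    have "(inv (h \<otimes> g) \<otimes> g) \<otimes> (inv (h [^] n \<otimes> g) \<otimes> g) \<in> P" using P_mult[OF hg step.IH] .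
    then show ?case using hc gc by (simp add: inv_mult_group m_assoc)
  qed
  obtain n where n: "n \<ge> 1" "inv h \<otimes> (f \<otimes> h [^] (n::nat)) \<in> P" using P_conrad[OF f h] by blast
  have "(inv h \<otimes> (f \<otimes> h [^] n)) \<otimes> g \<otimes> (inv (h [^] n \<otimes> g) \<otimes> g) \<in> P"
    using P_mult[OF P_mult[OF n(2) g] step[OF n(1)]] .
  also have "(inv h \<otimes> (f \<otimes> h [^] n)) \<otimes> g \<otimes> (inv (h [^] n \<otimes> g) \<otimes> g) = inv h \<otimes> (f \<otimes> g)"
    using hc fc gc by (simp add: m_assoc inv_mult_group)
  finally show False using one_notin_P hc by (simp add: h_def)
qed

text \<open>Each instance of a clause concerns finitely many memberships, and implications between
  memberships are written as disjunctions, so closedness can be read off clause by clause.\<close>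

lemma (in group) ccone_iff:
  "ccone G P \<longleftrightarrow>
     (\<forall>x. x \<notin> carrier G \<longrightarrow> x \<notin> P) \<and> \<one> \<notin> P \<and> (\<forall>x y. x \<notin> P \<or> y \<notin> P \<or> x \<otimes> y \<in> P) \<and>
     (\<forall>x. x \<in> carrier G - {\<one>} \<longrightarrow> x \<in> P \<or> inv x \<in> P) \<and>
     (\<forall>f g. f \<notin> P \<or> g \<notin> P \<or> inv g \<otimes> (f \<otimes> (g \<otimes> g)) \<in> P)"
    (is "?L \<longleftrightarrow> ?R")
proof
  assume ?L
  then interpret ccone G P .
  show ?R using P_sub one_notin_P P_mult P_total conrad_square by blast
next
  assume R: ?R
  show ?L
  proof
    show "P \<subseteq> carrier G" "\<one> \<notin> P" using R by blast+
    show "x \<otimes> y \<in> P" if "x \<in> P" "y \<in> P" for x y using R that by blast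
    show "x \<in> P \<or> inv x \<in> P" if "x \<in> carrier G" "x \<noteq> \<one>" for x using R that by blast
    fix f g assume fg: "f \<in> P" "g \<in> P"
    have "g \<in> carrier G" using R fg by blast
    then have "g [^] (2::nat) = g \<otimes> g" by (simp add: numeral_2_eq_2)
    moreover have "inv g \<otimes> (f \<otimes> (g \<otimes> g)) \<in> P" using R fg by blast
    ultimately show "\<exists>n\<ge>1::nat. inv g \<otimes> (f \<otimes> g [^] n) \<in> P" by (intro exI[of _ 2]) simp
  qed
qed

section \<open>The product topology on characteristic functions\<close>

abbreviation cantor :: "('a \<Rightarrow> bool) topology" where
  "cantor \<equiv> product_topology (\<lambda>_. discrete_topology UNIV) UNIV"

lemma topspace_cantor: "topspace cantor = UNIV"
  by simp

lemma compact_cantor: "compact_space cantor"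
  by (rule compact_space_product_topology[THEN iffD2]) (simp add: compact_space_discrete_topology)

lemma closedin_cantor_coord: "closedin cantor {p. p x = b}"
proof -
  have "continuous_map cantor (discrete_topology UNIV) (\<lambda>p. p x)"
    by (rule continuous_map_product_projection) simp
  then have "closedin cantor {p \<in> topspace cantor. p x \<in> {b}}"
    by (rule closedin_continuous_map_preimage) simp
  then show ?thesis by simp
qed

lemma closedin_cantor_mem: "closedin cantor {p. p x}" "closedin cantor {p. \<not> p x}"
  using closedin_cantor_coord[of x True] closedin_cantor_coord[of x False] by auto

lemma closedin_cantor_disj:
  assumes "closedin cantor {p. A p}" "closedin cantor {p. B p}"
  shows "closedin cantor {p. A p \<or> B p}"
  using closedin_Un[OF assms] by (simp add: Collect_disj_eq)

lemma closedin_cantor_conj: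
  assumes "closedin cantor {p. A p}" "closedin cantor {p. B p}"
  shows "closedin cantor {p. A p \<and> B p}"
  using closedin_Int[OF assms] by (simp add: Collect_conj_eq)

lemma closedin_cantor_all:
  assumes "\<And>x. closedin cantor {p. A x p}"
  shows "closedin cantor {p. \<forall>x. A x p}"
proof -
  have "closedin cantor (\<Inter>x. {p. A x p})" by (rule closedin_Inter) (use assms in auto)
  then show ?thesis by (simp add: Collect_all_eq)
qed

lemma closedin_cantor_imp:
  assumes "closedin cantor {p. A p}"
  shows "closedin cantor {p. Q \<longrightarrow> A p}"
  using assms closedin_topspace[of cantor] by (cases Q) (simp_all add: topspace_cantor)

lemma (in group) closedin_ccone: "closedin cantor {p. ccone G (Collect p)}"
  unfolding ccone_iff mem_Collect_eq
  by (intro closedin_cantor_conj closedin_cantor_all closedin_cantor_imp closedin_cantor_disj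
      closedin_cantor_mem)

text \<open>A diagonal argument against an enumeration \<open>c\<close>: finite sets of signs are
  frozen successively, the \<open>n\<close>-th extension ruling out \<open>c n\<close>, and
  compactness turns the nested conditions into a cone missed by \<open>c\<close>.\<close>

lemma (in group) uncountable_ccones:
  assumes ne: "\<exists>P. ccone G P"
    and niso: "\<And>P F. \<lbrakk>ccone G P; finite F; F \<subseteq> carrier G\<rbrakk>
      \<Longrightarrow> \<exists>P'. ccone G P' \<and> P' \<inter> F = P \<inter> F \<and> P' \<noteq> P"
  shows "uncountable {P. ccone G P}"
proof
  assume cnt: "countable {P. ccone G P}"
  define c where "c = from_nat_into {P. ccone G P}"
  have csurj: "\<exists>n. c n = P" if "ccone G P" for P
    using from_nat_into_surj[OF cnt, of P] that by (simp add: c_def)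
  \<comment> \<open>A state is a cone with the finite set of coordinates frozen so far, that is, a
    basic neighbourhood.\<close>
  define good :: "'a set \<times> 'a set \<Rightarrow> bool"
    where "good s \<longleftrightarrow> ccone G (fst s) \<and> finite (snd s) \<and> snd s \<subseteq> carrier G" for s
  define R where "R n s s' \<longleftrightarrow> snd s \<subseteq> snd s' \<and> fst s' \<inter> snd s = fst s \<inter> snd s
      \<and> fst s' \<inter> snd s' \<noteq> c n \<inter> snd s'" for n and s s' :: "'a set \<times> 'a set"
  have "\<exists>\<sigma>. \<forall>n. good (\<sigma> n) \<and> R n (\<sigma> n) (\<sigma> (Suc n))"
  proof (rule dependent_nat_choice)
    show "\<exists>s. good s" using ne by (auto simp: good_def intro!: exI[of _ "{}"])
    fix s n assume s: "good s"
    obtain Q where Q: "ccone G Q" "Q \<inter> snd s = fst s \<inter> snd s" "Q \<noteq> fst s"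
      using niso[of "fst s" "snd s"] s by (auto simp: good_def)
    \<comment> \<open>Of the two distinct cones \<open>fst s\<close> and \<open>Q\<close> in the
      neighbourhood, at least one differs from \<open>c n\<close>.\<close>
    obtain P where P: "ccone G P" "P \<inter> snd s = fst s \<inter> snd s" "P \<noteq> c n"
      using Q s by (metis good_def)
    have cc: "ccone G (c n)"
      using from_nat_into[of "{P. ccone G P}" n] ne by (auto simp: c_def)
    have "P \<subseteq> carrier G" "c n \<subseteq> carrier G" using ccone.P_sub P(1) cc by auto
    then obtain x where x: "x \<in> carrier G" "x \<in> P \<longleftrightarrow> x \<notin> c n" using P(3) by blast
    have "good (P, insert x (snd s))" using s P x by (auto simp: good_def)
    moreover have "R n s (P, insert x (snd s))" using P x by (auto simp: R_def)
    ultimately show "\<exists>s'. good s' \<and> R n s s'" by blast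
  qed
  then obtain \<sigma> where \<sigma>: "\<And>n. good (\<sigma> n)" "\<And>n. R n (\<sigma> n) (\<sigma> (Suc n))" by blast
  define K where "K n = {p. ccone G (Collect p) \<and> (\<forall>x. x \<in> snd (\<sigma> n) \<longrightarrow> p x = (x \<in> fst (\<sigma> n)))}" for n
  have "(\<Inter>n. K n) \<noteq> {}"
  proof (rule compact_space_imp_nest[OF compact_cantor])
    show "closedin cantor (K n)" for n unfolding K_def
      by (intro closedin_cantor_conj closedin_ccone closedin_cantor_all closedin_cantor_imp closedin_cantor_coord)
    show "K n \<noteq> {}" for n
    proof -
      have "(\<lambda>x. x \<in> fst (\<sigma> n)) \<in> K n" using \<sigma>(1)[of n] by (simp add: K_def good_def)
      then show ?thesis by blast
    qed
    show "decseq K"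
    proof (rule decseq_SucI)
      fix n
      show "K (Suc n) \<subseteq> K n" using \<sigma>(2)[of n] unfolding K_def R_def by blast
    qed
  qed
  then obtain p where p: "\<And>n. p \<in> K n" by blast
  then obtain n where n: "c n = Collect p" using csurj[of "Collect p"] by (auto simp: K_def)
  have "fst (\<sigma> (Suc n)) \<inter> snd (\<sigma> (Suc n)) = c n \<inter> snd (\<sigma> (Suc n))"
    using p[of "Suc n"] unfolding n K_def by blast
  then show False using \<sigma>(2)[of n] by (simp add: R_def)
qed

section \<open>Finiteness from an isolated cone, and transfer to orderings\<close>

lemma (in isolated_ccone) finite_ccones: "finite {P. ccone G P}"
proof -
  have "inj_on (\<lambda>P. P \<inter> F) {P. ccone G P}"
  proof (rule inj_onI)
    fix P1 P2 assume "P1 \<in> {P. ccone G P}" "P2 \<in> {P. ccone G P}" "P1 \<inter> F = P2 \<inter> F"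
    then show "P1 = P2"
      using ccone_determined_by_F[of P1 P2] ccone_determined_by_F[of P2 P1] by simp
  qed
  moreover have "(\<lambda>P. P \<inter> F) ` {P. ccone G P} \<subseteq> Pow F" by blast
  moreover have "finite (Pow F)" using F_finite by simp
  ultimately show ?thesis by (rule inj_on_finite)
qed

lemma isolated_ccone_of_isolated_CO:
  assumes "group G" and R: "R \<in> CO G" and "isolated_CO G R"
  shows "\<exists>F. isolated_ccone G (pos G R) F"
proof -
  obtain F where F: "finite F" "F \<subseteq> carrier G"
    and iso: "\<forall>R'\<in>CO G. pos G R' \<inter> F = pos G R \<inter> F \<longrightarrow> R' = R"
    using assms(3) unfolding isolated_CO_def by (elim exE conjE) (rule that)
  have "isolated_ccone G (pos G R) F"
  proof (intro isolated_ccone.intro isolated_ccone_axioms.intro ccone_pos(1)[OF assms(1) R] F)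
    fix P' assume P': "ccone G P'" "P' \<inter> F = pos G R \<inter> F"
    obtain R' where "R' \<in> CO G" "pos G R' = P'" using ccone.exists_ordering[OF P'(1)] by (elim bexE)
    then show "P' = pos G R" using iso P'(2) by metis
  qed
  then show ?thesis by (rule exI)
qed

theorem theoremC:
  fixes G :: "('a, 'b) monoid_scheme"
  assumes "group G"
    and "CO G \<noteq> {}"
    and "infinite (CO G)"
  shows "uncountable (CO G) \<and> (\<forall>R\<in>CO G. \<not> isolated_CO G R)"
proof -
  interpret group G by (rule assms(1))
  note cc = ccone_pos(1)[OF assms(1)] and ord = ccone_pos(2)[OF assms(1)]
  have inj: "inj_on (pos G) (CO G)"
  proof (rule inj_onI)
    fix R R' assume "R \<in> CO G" "R' \<in> CO G" "pos G R = pos G R'"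
    then show "R = R'" using ord[of R] ord[of R'] by simp
  qed
  have img: "pos G ` CO G = {P. ccone G P}"
  proof (intro equalityI subsetI)
    fix P assume "P \<in> {P. ccone G P}"
    then show "P \<in> pos G ` CO G" using ccone.exists_ordering[of G P] by force
  qed (use cc in auto)
  have inf: "infinite {P. ccone G P}"
    using finite_imageD[OF _ inj] img assms(3) by auto
  have niso: "\<not> isolated_CO G R" if R: "R \<in> CO G" for R
    using isolated_ccone_of_isolated_CO[OF assms(1) R] isolated_ccone.finite_ccones[of G] inf
    by metis
  have "uncountable {P. ccone G P}"
  proof (rule uncountable_ccones)
    show "\<exists>P. ccone G P" using inf by (metis (mono_tags) Collect_empty_eq finite.emptyI)
    fix P F assume P: "ccone G P" "finite F" "F \<subseteq> carrier G"
    show "\<exists>P'. ccone G P' \<and> P' \<inter> F = P \<inter> F \<and> P' \<noteq> P"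
    \<comment> \<open>Failure here says that \<open>F\<close> isolates \<open>P\<close>, and then
      only finitely many cones would exist.\<close>
    proof (rule ccontr)
      assume "\<not> ?thesis"
      then have "isolated_ccone G P F"
        using P by (intro isolated_ccone.intro isolated_ccone_axioms.intro) auto
      then show False using isolated_ccone.finite_ccones inf by blast
    qed
  qed
  then have "uncountable (CO G)" using countable_image[of "CO G" "pos G"] img by metis
  then show ?thesis using niso by blast
qed

end
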